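(* Let $\mathcal{E}$ be a separable infinite dimensional real Banach space and let $P = P(\mathcal{E})$ be a matricial Banach perturbation class on $\mathcal{E}$. Let $\{E_n\}_{n=1}^\infty$, with closed complements $\{E^{\infty-n}\}_{n=1}^\infty$, be an $\mathbb{N}$-flag in $\mathcal{E}$ for which the induced sequence $\{M(n)\}_{n=1}^\infty$ is a $\Delta$-flag in the Banach space $P$ with $\Delta=\{n^2\}_{n=1}^\infty$. Then the induced sequence of groups $\{\mathrm{GL}(n)\}_{n=1}^\infty$ is a Fredholm $\Delta$-filtration of the Banach manifold $M = \mathrm{GL}_P(\mathcal{E})$ with dimension sequence $\Delta = \{n^2\}_{n=1}^\infty$.
   Context: Notation: $\mathcal{L}(\mathcal{E})$ is the Banach algebra of bounded linear operators on $\mathcal{E}$; $\mathcal{F}(\mathcal{E})$ the bounded finite rank operators; $\Phi(\mathcal{E})$ the Fredholm operators on $\mathcal{E}$; $\mathrm{GL}(\mathcal{E})$ the group of invertible elements of $\mathcal{L}(\mathcal{E})$, with identity $I$. Perturbation class: a subspace $P(\mathcal{E})\subseteq\mathcal{L}(\mathcal{E})$ such that (1) $\mathcal{F}(\mathcal{E})\subseteq P(\mathcal{E})$; (2) $P(\mathcal{E})$ is an ideal in $\mathcal{L}(\mathcal{E})$; (3) $\Phi(\mathcal{E})+P(\mathcal{E})=\Phi(\mathcal{E})$. It is a Banach perturbation class if it has a complete algebra norm such that the inclusion $P(\mathcal{E})\hookrightarrow\mathcal{L}(\mathcal{E})$ is continuous; $P$ is then regarded as a Banach space with this norm. $\Delta$-flag: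 let $\Delta=\{\delta(n)\}_{n=1}^\infty$ be a strictly increasing sequence of natural numbers. A $\Delta$-flag in a Banach space $B$ is a sequence $\{B_n\}_{n=1}^\infty$ of finite-dimensional subspaces of $B$ such that for all $n\ge 1$: (a) $\dim(B_n)=\delta(n)$; (b) $B_n\subset B_{n+1}$; (c) $\bigcup_{n} B_n$ is dense in $B$; (d) $B_n$ has a closed complement $B^{\infty-n}$ in $B$; (e) $B^{\infty-n}\supset B^{\infty-(n+1)}$. The complements $B^{\infty-n}$ are part of the data. An $\mathbb{N}$-flag is a $\Delta$-flag with $\delta(n)=n$ for all $n$. Induced sequences: given an $\mathbb{N}$-flag $\{E_n\}$ in $\mathcal{E}$ with complements $E^{\infty-n}$, $M(n)\subset\mathcal{F}(\mathcal{E})\subseteq P(\mathcal{E})$ is the algebra of all operators in $\mathcal{L}(\mathcal{E})$ that map $E_n$ to itself and are zero on $E^{\infty-n}$ (so $M(n)\cong\mathcal{L}(E_n)$, $\dim M(n)=n^2$, and $M(n)\subset M(n+1)$). $\mathrm{GL}(n)$ is the subgroup of $\mathrm{GL}(\mathcal{E})$ of operators that map $E_n$ to itself and are the identity on $E^{\infty-n}$ (so $\mathrm{GL}(n)\cong\mathrm{GL}(E_n)$ and $\mathrm{GL}(n)\subset\mathrm{GL}(n+1)\subset\mathrm{GL}_P(\mathcal{E})$). Matricial: a Banach perturbation class $P=P(\mathcal{E})$ is matricial if there is an $\mathbb{N}$-flag in $\mathcal{E}$ such that the induced sequence $\{M(n)\}_{n=1}^\infty$ is a $\Delta$-flag in the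 Banach space $P$ with $\Delta=\{n^2\}_{n=1}^\infty$. Fredholm group: $\mathrm{GL}_P(\mathcal{E})=\mathrm{GL}(\mathcal{E})\cap(I+P(\mathcal{E}))$, with the topology and smooth Banach manifold structure modelled on $P$ for which the bijection $I+K\mapsto K$ onto the open subset $\mathcal{O}=\{K\in P : I+K \text{ is invertible}\}$ of $P$ is a diffeomorphism (a global chart). Fredholm map: a smooth map $f:M\to N$ of smooth Banach manifolds is Fredholm of index zero if for each $x\in M$ the differential $Df(x):T_xM\to T_{f(x)}N$ is a Fredholm operator of index $0$. Fredholm $\Delta$-filtration: let $M$ be a smooth Banach manifold and $\Delta=\{\delta(n)\}_{n=1}^\infty$ a strictly increasing sequence of natural numbers. A Fredholm $\Delta$-filtration of $M$ is a sequence $\{M_n\}_{n=1}^\infty$ of smooth submanifolds of $M$ such that for all $n\ge1$: (a) $\dim(M_n)=\delta(n)$; (b) $M_n\subset M_{n+1}$; (c) the embeddings $M_n\hookrightarrow M_{n+1}$ and $M_n\hookrightarrow M$ have trivial normal bundles; (d) $M_\infty=\bigcup_{n=1}^\infty M_n$ is dense in $M$; (e) if $M_\infty$ is given the inductive limit topology, the inclusion $M_\infty\hookrightarrow M$ is a homotopy equivalence; (f) there is a Fredholm map of index zero $f:M\to B$ to a Banach space $B$ that is transverse to (each term of) a $\Delta$-flag $\{B_n\}_{n=1}^\infty$ of $B$ for which $M_n=f^{-1}(B_n)$ for all $n\ge1$. *)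

theory Defs
  imports "HOL-Analysis.Analysis"
begin

section \<open>Subspaces and flags\<close>

definition finite_dim :: "'a::real_vector set \<Rightarrow> bool" where
  "finite_dim V \<longleftrightarrow> (\<exists>B. finite B \<and> V = span B)"

text \<open>\<^const>\<open>dim\<close> is \<open>0\<close> on infinite-dimensional spaces, hence the first conjunct.\<close>

definition has_dim :: "'a::real_vector set \<Rightarrow> nat \<Rightarrow> bool" where
  "has_dim V n \<longleftrightarrow> finite_dim V \<and> dim V = n"

definition alg_complement :: "'a::real_vector set \<Rightarrow> 'a set \<Rightarrow> bool" where
  "alg_complement V W \<longleftrightarrow>
     subspace W \<and> V \<inter> W = {0} \<and> {v + w |v w. v \<in> V \<and> w \<in> W} = UNIV"

definition closed_complement :: "'a::real_normed_vector set \<Rightarrow> 'a set \<Rightarrow> bool" where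
  "closed_complement V W \<longleftrightarrow> alg_complement V W \<and> closed W"

text \<open>Sequences are indexed by \<open>n \<ge> 1\<close>; the entry at \<open>0\<close> is irrelevant throughout.
  The complements \<open>BC n\<close> are part of the data of a flag.\<close>

definition delta_flag :: "(nat \<Rightarrow> nat) \<Rightarrow> (nat \<Rightarrow> 'b::banach set) \<Rightarrow> (nat \<Rightarrow> 'b set) \<Rightarrow> bool" where
  "delta_flag \<delta> B BC \<longleftrightarrow>
     strict_mono_on {1..} \<delta> \<and>
     (\<forall>n\<ge>1. has_dim (B n) (\<delta> n)) \<and>
     (\<forall>n\<ge>1. B n \<subseteq> B (Suc n)) \<and>
     closure (\<Union>n\<in>{1..}. B n) = UNIV \<and>
     (\<forall>n\<ge>1. closed_complement (B n) (BC n)) \<and>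
     (\<forall>n\<ge>1. BC (Suc n) \<subseteq> BC n)"

definition N_flag :: "(nat \<Rightarrow> 'b::banach set) \<Rightarrow> (nat \<Rightarrow> 'b set) \<Rightarrow> bool" where
  "N_flag = delta_flag (\<lambda>n. n)"


section \<open>Fredholm operators\<close>

definition codim :: "'a::real_vector set \<Rightarrow> nat" where
  "codim V = (THE n. \<exists>W. alg_complement V W \<and> has_dim W n)"

definition fredholm_operator :: "('a::real_normed_vector \<Rightarrow> 'b::real_normed_vector) \<Rightarrow> bool" where
  "fredholm_operator T \<longleftrightarrow>
     bounded_linear T \<and> finite_dim {x. T x = 0} \<and> closed (range T) \<and>
     (\<exists>W. alg_complement (range T) W \<and> finite_dim W)"

definition fredholm_index :: "('a::real_normed_vector \<Rightarrow> 'b::real_normed_vector) \<Rightarrow> int" where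
  "fredholm_index T = int (dim {x. T x = 0}) - int (codim (range T))"


section \<open>Perturbation classes\<close>

definition finite_rank_ops :: "('a::banach \<Rightarrow>\<^sub>L 'a) set" where
  "finite_rank_ops = {T. finite_dim (range (blinfun_apply T))}"

definition Fredholm_ops :: "('a::banach \<Rightarrow>\<^sub>L 'a) set" where
  "Fredholm_ops = {T. fredholm_operator (blinfun_apply T)}"

definition GL :: "('a::banach \<Rightarrow>\<^sub>L 'a) set" where
  "GL = {T. \<exists>S. S o\<^sub>L T = id_blinfun \<and> T o\<^sub>L S = id_blinfun}"

definition perturbation_class :: "('a::banach \<Rightarrow>\<^sub>L 'a) set \<Rightarrow> bool" where
  "perturbation_class P \<longleftrightarrow>
     subspace P \<and>
     finite_rank_ops \<subseteq> P \<and>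
     (\<forall>K\<in>P. \<forall>T. T o\<^sub>L K \<in> P \<and> K o\<^sub>L T \<in> P) \<and>
     {T + K |T K. T \<in> Fredholm_ops \<and> K \<in> P} = Fredholm_ops"

text \<open>A complete algebra norm on \<open>P\<close> differs in general from the operator norm. The Banach
  algebra obtained by giving \<open>P\<close> that norm is a type \<open>'p\<close> of its own, and \<open>incl\<close> is the
  (continuous) inclusion of it into the bounded operators, with image \<open>P\<close>.\<close>

definition banach_perturbation_class ::
    "('a::banach \<Rightarrow>\<^sub>L 'a) set \<Rightarrow> ('p::{real_normed_algebra,banach} \<Rightarrow> ('a \<Rightarrow>\<^sub>L 'a)) \<Rightarrow> bool" where
  "banach_perturbation_class P incl \<longleftrightarrow>
     perturbation_class P \<and>
     bounded_linear incl \<and> inj incl \<and> range incl = P \<and>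
     (\<forall>K L. incl (K * L) = incl K o\<^sub>L incl L)"

definition flag_M :: "(nat \<Rightarrow> 'a::banach set) \<Rightarrow> (nat \<Rightarrow> 'a set) \<Rightarrow> nat \<Rightarrow> ('a \<Rightarrow>\<^sub>L 'a) set" where
  "flag_M E EC n = {T. blinfun_apply T ` E n \<subseteq> E n \<and> (\<forall>x\<in>EC n. blinfun_apply T x = 0)}"

definition flag_GL :: "(nat \<Rightarrow> 'a::banach set) \<Rightarrow> (nat \<Rightarrow> 'a set) \<Rightarrow> nat \<Rightarrow> ('a \<Rightarrow>\<^sub>L 'a) set" where
  "flag_GL E EC n =
     {T \<in> GL. blinfun_apply T ` E n \<subseteq> E n \<and> (\<forall>x\<in>EC n. blinfun_apply T x = x)}"

definition induces_flag ::
    "('p::{real_normed_algebra,banach} \<Rightarrow> ('a::banach \<Rightarrow>\<^sub>L 'a)) \<Rightarrow>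
     (nat \<Rightarrow> 'a set) \<Rightarrow> (nat \<Rightarrow> 'a set) \<Rightarrow> bool" where
  "induces_flag incl E EC \<longleftrightarrow>
     (\<exists>MC. delta_flag (\<lambda>n. n^2) (\<lambda>n. incl -` flag_M E EC n) MC)"

definition matricial ::
    "('a::banach \<Rightarrow>\<^sub>L 'a) set \<Rightarrow> ('p::{real_normed_algebra,banach} \<Rightarrow> ('a \<Rightarrow>\<^sub>L 'a)) \<Rightarrow> bool" where
  "matricial P incl \<longleftrightarrow>
     banach_perturbation_class P incl \<and> (\<exists>E EC. N_flag E EC \<and> induces_flag incl E EC)"


section \<open>Smooth maps between Banach spaces\<close>

definition bounded_multilinear ::
    "nat \<Rightarrow> ('a::real_normed_vector list \<Rightarrow> 'b::real_normed_vector) \<Rightarrow> bool" where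
  "bounded_multilinear k m \<longleftrightarrow>
     (\<forall>vs i. length vs = k \<longrightarrow> i < k \<longrightarrow> linear (\<lambda>u. m (vs[i := u]))) \<and>
     (\<exists>C. \<forall>vs. length vs = k \<longrightarrow> norm (m vs) \<le> C * prod_list (map norm vs))"

text \<open>\<open>C\<^sup>\<infinity>\<close> in the sense of Frechet: \<open>D k x\<close> is the \<open>k\<close>-th derivative at \<open>x\<close>, a bounded
  \<open>k\<close>-linear map on argument lists of length \<open>k\<close>, and \<open>D (Suc k)\<close> is the Frechet derivative of
  \<open>D k\<close> with respect to the norm of bounded \<open>k\<close>-linear maps.\<close>

definition smooth_on ::
    "'a::real_normed_vector set \<Rightarrow> ('a \<Rightarrow> 'b::real_normed_vector) \<Rightarrow> bool" where
  "smooth_on S f \<longleftrightarrow> open S \<and>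
     (\<exists>D :: nat \<Rightarrow> 'a \<Rightarrow> 'a list \<Rightarrow> 'b.
        (\<forall>x\<in>S. D 0 x [] = f x) \<and>
        (\<forall>k. \<forall>x\<in>S. bounded_multilinear k (D k x)) \<and>
        (\<forall>k. \<forall>x\<in>S. \<forall>e>0. \<forall>\<^sub>F y in at x. \<forall>vs. length vs = k \<longrightarrow>
           norm (D k y vs - D k x vs - D (Suc k) x ((y - x) # vs))
             \<le> e * norm (y - x) * prod_list (map norm vs)))"

text \<open>Smoothness on a set that need not be open; on a split submanifold this is smoothness with
  respect to the submanifold structure.\<close>

definition locally_extends_smoothly ::
    "'a::real_normed_vector set \<Rightarrow> ('a \<Rightarrow> 'b::real_normed_vector) \<Rightarrow> bool" where
  "locally_extends_smoothly S g \<longleftrightarrow>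
     (\<forall>p\<in>S. \<exists>W h. p \<in> W \<and> smooth_on W h \<and> (\<forall>q\<in>S \<inter> W. h q = g q))"


section \<open>Banach manifolds\<close>

text \<open>A manifold is given by a topology on its underlying set and an atlas of charts
  \<open>(domain, map)\<close> into the model space \<open>'p\<close>; the atlas need not be maximal.\<close>

type_synonym ('x, 'p) chart = "'x set \<times> ('x \<Rightarrow> 'p)"

definition chart_inv :: "('x, 'p) chart \<Rightarrow> 'p \<Rightarrow> 'x" where
  "chart_inv c = inv_into (fst c) (snd c)"

definition is_chart :: "'x topology \<Rightarrow> ('x, 'p::banach) chart \<Rightarrow> bool" where
  "is_chart T c \<longleftrightarrow>
     openin T (fst c) \<and> open (snd c ` fst c) \<and>
     homeomorphic_map (subtopology T (fst c)) (top_of_set (snd c ` fst c)) (snd c)"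

definition charts_compatible :: "('x, 'p::banach) chart \<Rightarrow> ('x, 'p) chart \<Rightarrow> bool" where
  "charts_compatible c d \<longleftrightarrow>
     smooth_on (snd c ` (fst c \<inter> fst d)) (snd d \<circ> chart_inv c) \<and>
     smooth_on (snd d ` (fst c \<inter> fst d)) (snd c \<circ> chart_inv d)"

definition smooth_banach_manifold :: "'x topology \<Rightarrow> ('x, 'p::banach) chart set \<Rightarrow> bool" where
  "smooth_banach_manifold T A \<longleftrightarrow>
     Hausdorff_space T \<and>
     (\<forall>c\<in>A. is_chart T c) \<and>
     (\<Union>c\<in>A. fst c) = topspace T \<and>
     (\<forall>c\<in>A. \<forall>d\<in>A. charts_compatible c d)"

text \<open>Submanifolds of finite dimension \<open>d\<close>. The slices \<open>F\<close> are finite-dimensional, so they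
  are automatically closed and complemented in the model space.\<close>

definition smooth_submanifold ::
    "'x topology \<Rightarrow> ('x, 'p::banach) chart set \<Rightarrow> nat \<Rightarrow> 'x set \<Rightarrow> bool" where
  "smooth_submanifold T A d N \<longleftrightarrow>
     N \<subseteq> topspace T \<and>
     (\<forall>x\<in>N. \<exists>c F. is_chart T c \<and> (\<forall>a\<in>A. charts_compatible c a) \<and> x \<in> fst c \<and>
        has_dim F d \<and> snd c ` (fst c \<inter> N) = snd c ` fst c \<inter> F)"

definition smooth_map :: "('x, 'p::banach) chart set \<Rightarrow> ('x \<Rightarrow> 'b::banach) \<Rightarrow> bool" where
  "smooth_map A f \<longleftrightarrow> (\<forall>c\<in>A. smooth_on (snd c ` fst c) (f \<circ> chart_inv c))"

text \<open>A chart \<open>c\<close> around \<open>x\<close> identifies the tangent space at \<open>x\<close> with the model space \<open>'p\<close>;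
  \<open>chart_deriv c f x\<close> is the differential of \<open>f\<close> at \<open>x\<close> under this identification. For another
  chart \<open>d\<close> around \<open>x\<close>, \<open>chart_deriv c (snd d) x\<close> is the change of identification.\<close>

definition chart_deriv ::
    "('x, 'p::banach) chart \<Rightarrow> ('x \<Rightarrow> 'b::banach) \<Rightarrow> 'x \<Rightarrow> 'p \<Rightarrow> 'b" where
  "chart_deriv c f x = frechet_derivative (f \<circ> chart_inv c) (at (snd c x))"

definition fredholm_map_index_zero ::
    "('x, 'p::banach) chart set \<Rightarrow> ('x \<Rightarrow> 'b::banach) \<Rightarrow> bool" where
  "fredholm_map_index_zero A f \<longleftrightarrow>
     smooth_map A f \<and>
     (\<forall>c\<in>A. \<forall>x\<in>fst c. fredholm_operator (chart_deriv c f x) \<and>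
                         fredholm_index (chart_deriv c f x) = 0)"

definition transverse ::
    "('x, 'p::banach) chart set \<Rightarrow> ('x \<Rightarrow> 'b::banach) \<Rightarrow> 'b set \<Rightarrow> bool" where
  "transverse A f S \<longleftrightarrow>
     (\<forall>c\<in>A. \<forall>x\<in>fst c. f x \<in> S \<longrightarrow>
        {u + s |u s. u \<in> range (chart_deriv c f x) \<and> s \<in> S} = UNIV \<and>
        (\<exists>W. closed_complement (chart_deriv c f x -` S) W))"


section \<open>Normal bundles\<close>

text \<open>The tangent space of \<open>N\<close> at \<open>x\<close>, read in the chart \<open>c\<close>: velocities of smooth curves.\<close>

definition tangent_space :: "('x, 'p::banach) chart \<Rightarrow> 'x set \<Rightarrow> 'x \<Rightarrow> 'p set" where
  "tangent_space c N x =
     {v. \<exists>\<gamma>::real \<Rightarrow> 'p. \<exists>e>0. smooth_on {-e<..<e} \<gamma> \<and> \<gamma> 0 = snd c x \<and>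
           \<gamma> ` {-e<..<e} \<subseteq> snd c ` (fst c \<inter> N) \<and> (\<gamma> has_vector_derivative v) (at 0)}"

text \<open>The coset of \<open>v\<close> in the quotient of the tangent spaces of \<open>N'\<close> and \<open>N\<close>, for \<open>N \<subseteq> N'\<close>;
  \<open>N'\<close> is a submanifold or the whole manifold.\<close>

definition normal_class :: "('x, 'p::banach) chart \<Rightarrow> 'x set \<Rightarrow> 'x \<Rightarrow> 'p \<Rightarrow> 'p set" where
  "normal_class c N x v = (\<lambda>w. v + w) ` tangent_space c N x"

definition normal_fibre :: "('x, 'p::banach) chart \<Rightarrow> 'x set \<Rightarrow> 'x set \<Rightarrow> 'x \<Rightarrow> 'p set set" where
  "normal_fibre c N N' x = normal_class c N x ` tangent_space c N' x"

text \<open>A trivialisation of the normal bundle of \<open>N\<close> in \<open>N'\<close>: linear isomorphisms \<open>\<tau>\<close> of the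
  fibres onto a fixed Banach space \<open>V\<close>, independent of the chart in which the fibre is read, that
  depend smoothly on the base point; smoothness on the quotient bundle means smoothness after
  composition with the projection from the restriction to \<open>N\<close> of the tangent bundle of \<open>N'\<close>.
  Fibres are isomorphic to closed subspaces of \<open>'p\<close>, so it is no restriction to take \<open>V\<close> to be
  one; continuity of the fibrewise inverses is the open mapping theorem.\<close>

definition trivial_normal_bundle ::
    "('x, 'p::banach) chart set \<Rightarrow> 'x set \<Rightarrow> 'x set \<Rightarrow> bool" where
  "trivial_normal_bundle A N N' \<longleftrightarrow>
     (\<exists>(V::'p set) (\<tau> :: ('x, 'p) chart \<Rightarrow> 'x \<Rightarrow> 'p set \<Rightarrow> 'p).
        subspace V \<and> closed V \<and>
        (\<forall>c\<in>A. \<forall>x\<in>fst c \<inter> N.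
           bij_betw (\<tau> c x) (normal_fibre c N N' x) V \<and>
           (\<forall>u\<in>tangent_space c N' x. \<forall>v\<in>tangent_space c N' x. \<forall>r s.
              \<tau> c x (normal_class c N x (r *\<^sub>R u + s *\<^sub>R v)) =
                r *\<^sub>R \<tau> c x (normal_class c N x u) + s *\<^sub>R \<tau> c x (normal_class c N x v))) \<and>
        (\<forall>c\<in>A. \<forall>d\<in>A. \<forall>x\<in>fst c \<inter> fst d \<inter> N. \<forall>X\<in>normal_fibre c N N' x.
           \<tau> d x (chart_deriv c (snd d) x ` X) = \<tau> c x X) \<and>
        (\<forall>c\<in>A. locally_extends_smoothly
           {(snd c x, v) |x v. x \<in> fst c \<inter> N \<and> v \<in> tangent_space c N' x}
           (\<lambda>(y, v). \<tau> c (chart_inv c y) (normal_class c N (chart_inv c y) v))))"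


section \<open>Fredholm filtrations\<close>

definition inductive_limit_topology :: "'x topology \<Rightarrow> (nat \<Rightarrow> 'x set) \<Rightarrow> 'x topology" where
  "inductive_limit_topology T N =
     topology (\<lambda>U. U \<subseteq> (\<Union>n\<in>{1..}. N n) \<and> (\<forall>n\<ge>1. openin (subtopology T (N n)) (U \<inter> N n)))"

lemma openin_inductive_limit_topology:
  "openin (inductive_limit_topology T N) U \<longleftrightarrow>
     U \<subseteq> (\<Union>n\<in>{1..}. N n) \<and> (\<forall>n\<ge>1. openin (subtopology T (N n)) (U \<inter> N n))"
proof -
  let ?L = "\<lambda>U. U \<subseteq> (\<Union>n\<in>{1..}. N n) \<and> (\<forall>n\<ge>1. openin (subtopology T (N n)) (U \<inter> N n))"
  have "?L (S \<inter> S')" if "?L S" "?L S'" for S S'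
  proof (intro conjI allI impI)
    show "S \<inter> S' \<subseteq> (\<Union>n\<in>{1..}. N n)"
      using that(1) by (meson inf.coboundedI1)
    fix n :: nat
    assume "1 \<le> n"
    then have "openin (subtopology T (N n)) ((S \<inter> N n) \<inter> (S' \<inter> N n))"
      using that by (intro openin_Int[of _ "S \<inter> N n" "S' \<inter> N n"]) blast+
    moreover have "(S \<inter> N n) \<inter> (S' \<inter> N n) = S \<inter> S' \<inter> N n"
      by auto
    ultimately show "openin (subtopology T (N n)) (S \<inter> S' \<inter> N n)"
      by simp
  qed
  moreover have "?L (\<Union>\<K>)" if "\<forall>K\<in>\<K>. ?L K" for \<K>
  proof (intro conjI allI impI)
    show "\<Union>\<K> \<subseteq> (\<Union>n\<in>{1..}. N n)"
      using that by (intro Union_least) simp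
    fix n :: nat
    assume "1 \<le> n"
    then have "openin (subtopology T (N n)) (\<Union>K\<in>\<K>. K \<inter> N n)"
      using that by (intro openin_Union) auto
    moreover have "(\<Union>K\<in>\<K>. K \<inter> N n) = \<Union>\<K> \<inter> N n"
      by auto
    ultimately show "openin (subtopology T (N n)) (\<Union>\<K> \<inter> N n)"
      by simp
  qed
  ultimately have "istopology ?L"
    unfolding istopology_def by meson
  then show ?thesis
    unfolding inductive_limit_topology_def by (simp only: topology_inverse')
qed

definition homotopy_equivalence :: "'x topology \<Rightarrow> 'y topology \<Rightarrow> ('x \<Rightarrow> 'y) \<Rightarrow> bool" where
  "homotopy_equivalence X Y f \<longleftrightarrow>
     continuous_map X Y f \<and>
     (\<exists>g. continuous_map Y X g \<and>
          homotopic_with (\<lambda>_. True) X X (g \<circ> f) id \<and>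
          homotopic_with (\<lambda>_. True) Y Y (f \<circ> g) id)"

text \<open>The type argument is the Banach space \<open>B\<close> that is the target of the Fredholm map.\<close>

definition fredholm_filtration ::
    "'b::banach itself \<Rightarrow> 'x topology \<Rightarrow> ('x, 'p::banach) chart set \<Rightarrow>
     (nat \<Rightarrow> nat) \<Rightarrow> (nat \<Rightarrow> 'x set) \<Rightarrow> bool" where
  "fredholm_filtration (_ :: 'b itself) T A \<delta> N \<longleftrightarrow>
     smooth_banach_manifold T A \<and>
     strict_mono_on {1..} \<delta> \<and>
     (\<forall>n\<ge>1. smooth_submanifold T A (\<delta> n) (N n)) \<and>
     (\<forall>n\<ge>1. N n \<subseteq> N (Suc n)) \<and>
     (\<forall>n\<ge>1. trivial_normal_bundle A (N n) (N (Suc n)) \<and>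
              trivial_normal_bundle A (N n) (topspace T)) \<and>
     T closure_of (\<Union>n\<in>{1..}. N n) = topspace T \<and>
     homotopy_equivalence (inductive_limit_topology T N) T id \<and>
     (\<exists>(f :: 'x \<Rightarrow> 'b) B BC.
        fredholm_map_index_zero A f \<and>
        delta_flag \<delta> B BC \<and>
        (\<forall>n\<ge>1. transverse A f (B n) \<and> N n = {x \<in> topspace T. f x \<in> B n}))"


section \<open>The Fredholm group\<close>

definition GL_P :: "('a::banach \<Rightarrow>\<^sub>L 'a) set \<Rightarrow> ('a \<Rightarrow>\<^sub>L 'a) set" where
  "GL_P P = GL \<inter> {id_blinfun + K |K. K \<in> P}"

definition GL_P_coord ::
    "('p::banach \<Rightarrow> ('a::banach \<Rightarrow>\<^sub>L 'a)) \<Rightarrow> ('a \<Rightarrow>\<^sub>L 'a) \<Rightarrow> 'p" where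
  "GL_P_coord incl T = the_inv incl (T - id_blinfun)"

definition GL_P_topology ::
    "('a::banach \<Rightarrow>\<^sub>L 'a) set \<Rightarrow> ('p::banach \<Rightarrow> ('a \<Rightarrow>\<^sub>L 'a)) \<Rightarrow> ('a \<Rightarrow>\<^sub>L 'a) topology" where
  "GL_P_topology P incl = pullback_topology (GL_P P) (GL_P_coord incl) euclidean"

definition GL_P_atlas ::
    "('a::banach \<Rightarrow>\<^sub>L 'a) set \<Rightarrow> ('p::banach \<Rightarrow> ('a \<Rightarrow>\<^sub>L 'a)) \<Rightarrow> ('a \<Rightarrow>\<^sub>L 'a, 'p) chart set" where
  "GL_P_atlas P incl = {(GL_P P, GL_P_coord incl)}"

end

theory Submission
  imports Defs
begin

text \<open>
  The Fredholm map can be taken to be the global chart \<open>I + K \<mapsto> K\<close> itself: its differential is the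
  identity, hence Fredholm of index zero and transverse to everything that has a closed
  complement, and the preimage of \<open>M(n)\<close> is \<open>GL(n)\<close>, because \<open>I + K\<close> preserves \<open>E\<^sub>n\<close> and fixes the
  complement pointwise exactly when \<open>K\<close> preserves \<open>E\<^sub>n\<close> and kills the complement. So in the chart
  the theorem is about an open subset \<open>U\<close> of a Banach space and its intersections with a flag
  \<open>F\<^sub>n\<close> (\<open>fredholm_filtration_slices\<close>); the group structure enters only through the openness of the
  set of invertible operators (\<open>open_GL\<close>), which makes the image of the chart open.

  For open \<open>U\<close> the slices \<open>U \<inter> F\<^sub>n\<close> have constant tangent space \<open>F\<^sub>n\<close>, so the normal bundle is
  trivialised by the projection along \<open>F\<^sub>n\<close> onto its complement. That projection is bounded
  because \<open>F\<^sub>n\<close> is finite-dimensional and the complement is closed (\<open>projection_along_finite_dim\<close>).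

  The substantial part is that the union of the slices, with the inductive limit topology, is
  homotopy equivalent to \<open>U\<close> (\<open>homotopy_equivalence_inductive_limit\<close>, a theorem of Palais). A
  homotopy inverse \<open>g\<close> is built from a partition of unity that averages points of a countable
  dense subset of the union of the \<open>F\<^sub>n\<close>. It moves every point of \<open>U\<close> so little that the segment
  from \<open>x\<close> to \<open>g x\<close> stays in \<open>U\<close>, and locally it takes values in a single \<open>F\<^sub>n\<close>, which gives
  continuity into the inductive limit (\<open>dense_sequence_approximates_identity\<close>). The
  straight-line homotopy from the identity to \<open>g\<close> then works for both composites. On the
  inductive limit its continuity can be tested on each \<open>[0,1] \<times> (U \<inter> F\<^sub>n)\<close>, by the tube lemma
  (\<open>continuous_map_prod_inductive_limit\<close>).
\<close>

section \<open>Finite-dimensional subspaces and projections\<close>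

text \<open>A ball of radius \<open>r\<close> around \<open>b\<close> misses the closed set \<open>W\<close>; scaling by \<open>t\<close> gives the estimate.\<close>

lemma norm_le_add_line:
  fixes W :: "'a::real_normed_vector set"
  assumes W: "subspace W" "closed W" and b: "b \<notin> W"
  obtains r where "r > 0" and "\<And>w t. w \<in> W \<Longrightarrow> \<bar>t\<bar> * r \<le> norm (w + t *\<^sub>R b)"
proof -
  have "open (- W)" "b \<in> - W"
    using W b by auto
  then obtain r where r: "r > 0" "ball b r \<subseteq> - W"
    by (meson open_contains_ball)
  have "\<bar>t\<bar> * r \<le> norm (w + t *\<^sub>R b)" if w: "w \<in> W" for w t
  proof (cases "t = 0")
    case False
    have "(- 1 / t) *\<^sub>R w \<in> W"
      using subspace_scale[OF W(1) w] .
    with r have "r \<le> dist b ((- 1 / t) *\<^sub>R w)"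
      by (meson ComplD linorder_not_less mem_ball subsetD)
    then have "\<bar>t\<bar> * r \<le> \<bar>t\<bar> * norm (b + (1 / t) *\<^sub>R w)"
      by (simp add: dist_norm mult_left_mono)
    also have "\<dots> = norm (t *\<^sub>R (b + (1 / t) *\<^sub>R w))"
      by simp
    also have "t *\<^sub>R (b + (1 / t) *\<^sub>R w) = w + t *\<^sub>R b"
      using False by (simp add: scaleR_add_right)
    finally show ?thesis .
  qed simp
  with r show ?thesis
    using that by blast
qed

text \<open>If \<open>w\<^sub>n + k\<^sub>n b\<close> converges, then \<open>norm_le_add_line\<close> makes the scalars \<open>k\<^sub>n\<close> a Cauchy sequence,
  so both summands converge.\<close>

lemma closed_add_line:
  fixes W :: "'a::real_normed_vector set"
  assumes W: "subspace W" "closed W"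
  shows "closed (span (insert b W))"
proof (cases "b \<in> W")
  case True
  moreover have "span W = W"
    using W(1) by (simp only: span_eq_iff)
  ultimately show ?thesis
    using W(2) by (metis insert_absorb)
next
  case False
  obtain r where r: "r > 0" "\<And>w t. w \<in> W \<Longrightarrow> \<bar>t\<bar> * r \<le> norm (w + t *\<^sub>R b)"
    using norm_le_add_line[OF W False] by blast
  have "span W = W"
    using W(1) by (simp only: span_eq_iff)
  then have eq: "span (insert b W) = {x. \<exists>k. x - k *\<^sub>R b \<in> W}"
    by (simp only: span_insert)
  show ?thesis
    unfolding closed_sequential_limits
  proof (intro allI impI, elim conjE)
    fix x l
    assume x: "\<forall>n. x n \<in> span (insert b W)" and l: "x \<longlonglongrightarrow> l"
    then have "\<forall>n. \<exists>k. x n - k *\<^sub>R b \<in> W"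
      by (simp add: eq)
    then obtain k where k: "\<And>n. x n - k n *\<^sub>R b \<in> W"
      by metis
    have le: "\<bar>k m - k n\<bar> * r \<le> norm (x m - x n)" for m n
    proof -
      have "(x m - k m *\<^sub>R b) - (x n - k n *\<^sub>R b) \<in> W"
        using W k by (simp add: subspace_diff)
      from r(2)[OF this, of "k m - k n"] show ?thesis
        by (simp add: algebra_simps)
    qed
    have "Cauchy k"
    proof (rule metric_CauchyI)
      fix e :: real
      assume "e > 0"
      then obtain M where M: "\<And>m n. m \<ge> M \<Longrightarrow> n \<ge> M \<Longrightarrow> dist (x m) (x n) < e * r"
        using r(1) LIMSEQ_imp_Cauchy[OF l] unfolding Cauchy_def by (metis mult_pos_pos)
      have "dist (k m) (k n) < e" if "m \<ge> M" "n \<ge> M" for m n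
      proof -
        have "\<bar>k m - k n\<bar> * r < e * r"
          using le[of m n] M[OF that] by (simp add: dist_norm)
        then show ?thesis
          using r(1) by (simp add: dist_real_def)
      qed
      then show "\<exists>M. \<forall>m\<ge>M. \<forall>n\<ge>M. dist (k m) (k n) < e"
        by blast
    qed
    then obtain t where t: "k \<longlonglongrightarrow> t"
      using Cauchy_convergent convergent_def by blast
    have "(\<lambda>n. x n - k n *\<^sub>R b) \<longlonglongrightarrow> l - t *\<^sub>R b"
      using l t by (intro tendsto_intros)
    then have "l - t *\<^sub>R b \<in> W"
      using W(2) k by (meson closed_sequentially)
    then show "l \<in> span (insert b W)"
      unfolding eq by blast
  qed
qed

lemma closed_finite_dim:
  fixes V :: "'a::real_normed_vector set"
  assumes "finite_dim V"
  shows "closed V"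
proof -
  obtain B where B: "finite B" "V = span B"
    using assms by (auto simp: finite_dim_def)
  from B(1) have "closed (span B)"
  proof induction
    case (insert b B)
    have "span (insert b (span B)) = span (insert b B)"
      by (simp add: span_insert span_span)
    then show ?case
      using closed_add_line[of "span B" b] insert by simp
  qed simp
  then show ?thesis
    using B by simp
qed

text \<open>The angle between a finite-dimensional space and a closed complement is positive. By induction
  on the spanning set: the new vector is moved over to \<open>W\<close>, which stays closed by
  \<open>closed_add_line\<close>, and \<open>norm_le_add_line\<close> controls its coefficient. Hence \<open>W\<close> has to be arbitrary in the
  induction.\<close>

lemma finite_span_complement_bound:
  fixes W :: "'a::real_normed_vector set"
  assumes "finite B" "subspace W" "closed W" "span B \<inter> W = {0}"
  shows "\<exists>C\<ge>0. \<forall>f\<in>span B. \<forall>w\<in>W. norm f \<le> C * norm (f + w)"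
  using assms
proof (induction B arbitrary: W rule: finite_induct)
  case empty
  then show ?case
    by (auto intro: exI[of _ 0])
next
  case (insert b B)
  have sub: "span B \<subseteq> span (insert b B)" and bin: "b \<in> span (insert b B)"
    by (auto simp: span_mono span_base subset_insertI)
  show ?case
  proof (cases "b \<in> span B")
    case True
    then have "span (insert b B) = span B"
      by (simp add: span_redundant)
    then show ?thesis
      using insert by simp
  next
    case False
    have "b \<noteq> 0"
      using False span_0 by metis
    then have "b \<notin> W"
      using insert.prems(3) bin by auto
    define W' where "W' = span (insert b W)"
    have "span W = W"
      using insert.prems(1) by (simp only: span_eq_iff)
    then have W': "W' = {x. \<exists>k. x - k *\<^sub>R b \<in> W}"
      by (simp only: W'_def span_insert)
    have "span B \<inter> W' = {0}"
    proof (intro equalityI subsetI)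
      fix f assume "f \<in> span B \<inter> W'"
      then obtain k where f: "f \<in> span B" and k: "f - k *\<^sub>R b \<in> W"
        by (auto simp: W')
      have "f - k *\<^sub>R b \<in> span (insert b B)"
        using f sub bin by (auto intro!: span_diff span_scale)
      then have "f - k *\<^sub>R b \<in> span (insert b B) \<inter> W"
        using k by blast
      then have 0: "f = k *\<^sub>R b"
        unfolding insert.prems(3) by simp
      have "k = 0"
      proof (rule ccontr)
        assume "k \<noteq> 0"
        then have "b = (1 / k) *\<^sub>R f"
          using 0 by simp
        then show False
          using False f by (metis span_scale)
      qed
      then show "f \<in> {0}"
        using 0 by simp
    qed (use W'_def span_0 in auto)
    moreover have "subspace W'" "closed W'"
      unfolding W'_def using insert.prems closed_add_line by (auto simp: subspace_span)
    ultimately obtain C where C: "C \<ge> 0" "\<And>f w. f \<in> span B \<Longrightarrow> w \<in> W' \<Longrightarrow> norm f \<le> C * norm (f + w)"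
      using insert.IH by meson
    obtain r where r: "r > 0" "\<And>w t. w \<in> W \<Longrightarrow> \<bar>t\<bar> * r \<le> norm (w + t *\<^sub>R b)"
      using norm_le_add_line[OF insert.prems(1,2) \<open>b \<notin> W\<close>] by blast
    \<comment> \<open>\<open>norm f \<le> C * norm (g + w)\<close> and \<open>\<bar>k\<bar> * r \<le> (1 + C) * norm (g + w)\<close> add up to this constant.\<close>
    define K where "K = C + (1 + C) / r * norm b"
    have "norm g \<le> K * norm (g + w)" if g: "g \<in> span (insert b B)" and w: "w \<in> W" for g w
    proof -
      obtain k where k: "g - k *\<^sub>R b \<in> span B"
        using g by (auto simp: span_insert)
      define f where "f = g - k *\<^sub>R b"
      have wk: "w + k *\<^sub>R b \<in> W'"
        using w by (auto simp: W' intro!: exI[of _ k])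
      have eq: "f + (w + k *\<^sub>R b) = g + w"
        by (simp add: f_def)
      have f: "norm f \<le> C * norm (g + w)"
        using C(2)[of f, OF _ wk] k eq by (simp add: f_def)
      have "w + k *\<^sub>R b = (g + w) - f"
        by (simp add: f_def)
      then have "norm (w + k *\<^sub>R b) \<le> norm (g + w) + norm f"
        by (metis norm_triangle_ineq4)
      then have "\<bar>k\<bar> * r \<le> (1 + C) * norm (g + w)"
        using r(2)[OF w, of k] f by (simp add: algebra_simps)
      then have "\<bar>k\<bar> \<le> (1 + C) / r * norm (g + w)"
        using r(1) by (simp add: field_simps)
      then have "\<bar>k\<bar> * norm b \<le> (1 + C) / r * norm (g + w) * norm b"
        by (rule mult_right_mono) simp
      moreover have "norm g \<le> norm f + \<bar>k\<bar> * norm b"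
        using norm_triangle_ineq[of f "k *\<^sub>R b"] by (simp add: f_def)
      ultimately show ?thesis
        using f by (simp add: K_def algebra_simps)
    qed
    moreover have "K \<ge> 0"
      using C(1) r(1) by (simp add: K_def)
    ultimately show ?thesis
      by blast
  qed
qed

text \<open>Uniqueness of the decomposition makes the component in \<open>W\<close> linear in \<open>x\<close>, and \<open>finite_span_complement_bound\<close> bounds it.\<close>

lemma projection_along_finite_dim:
  fixes F W :: "'a::real_normed_vector set"
  assumes F: "finite_dim F" and W: "closed_complement F W"
  obtains \<pi> where "bounded_linear \<pi>" "\<And>x. \<pi> x \<in> W" "\<And>x. x - \<pi> x \<in> F" "\<And>x w. w \<in> W \<Longrightarrow> x - w \<in> F \<Longrightarrow> w = \<pi> x"
proof -
  obtain B where B: "finite B" "F = span B"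
    using F by (auto simp: finite_dim_def)
  have subF: "subspace F"
    using B by (simp add: subspace_span)
  have W: "subspace W" "closed W" "F \<inter> W = {0}" "{v + w |v w. v \<in> F \<and> w \<in> W} = UNIV"
    using W by (auto simp: closed_complement_def alg_complement_def)
  have "\<exists>w. w \<in> W \<and> x - w \<in> F" for x
  proof -
    have "x \<in> {v + w |v w. v \<in> F \<and> w \<in> W}"
      using W(4) by simp
    then show ?thesis
      by force
  qed
  then obtain \<pi> where \<pi>: "\<And>x. \<pi> x \<in> W" "\<And>x. x - \<pi> x \<in> F"
    by metis
  have uniq: "w = \<pi> x" if "w \<in> W" "x - w \<in> F" for x w
  proof -
    have "(x - \<pi> x) - (x - w) \<in> F"
      using subF \<pi> that by (blast intro: subspace_diff)
    then have "w - \<pi> x \<in> F"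
      by simp
    moreover have "w - \<pi> x \<in> W"
      using W(1) \<pi>(1) that(1) by (blast intro: subspace_diff)
    ultimately have "w - \<pi> x \<in> F \<inter> W"
      by blast
    then show ?thesis
      unfolding W(3) by simp
  qed
  have add: "\<pi> (x + y) = \<pi> x + \<pi> y" for x y
  proof (rule uniq[symmetric])
    have "(x - \<pi> x) + (y - \<pi> y) \<in> F"
      using subF \<pi> by (blast intro: subspace_add)
    then show "x + y - (\<pi> x + \<pi> y) \<in> F"
      by (simp add: algebra_simps)
  qed (use W \<pi> in \<open>simp add: subspace_add\<close>)
  have scale: "\<pi> (r *\<^sub>R x) = r *\<^sub>R \<pi> x" for r x
  proof (rule uniq[symmetric])
    have "r *\<^sub>R (x - \<pi> x) \<in> F"
      using subF \<pi> by (blast intro: subspace_scale)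
    then show "r *\<^sub>R x - r *\<^sub>R \<pi> x \<in> F"
      by (simp add: algebra_simps)
  qed (use W \<pi> in \<open>simp add: subspace_scale\<close>)
  obtain C where C: "C \<ge> 0" "\<And>f w. f \<in> F \<Longrightarrow> w \<in> W \<Longrightarrow> norm f \<le> C * norm (f + w)"
    using finite_span_complement_bound[OF B(1) W(1,2)] W(3) B(2) by metis
  have "norm (\<pi> x) \<le> norm x * (1 + C)" for x
  proof -
    have "norm (x - \<pi> x) \<le> C * norm x"
      using C(2)[OF \<pi>(2)[of x] \<pi>(1)[of x]] by simp
    moreover have "norm (\<pi> x) \<le> norm x + norm (x - \<pi> x)"
      using norm_triangle_ineq4[of x "x - \<pi> x"] by simp
    ultimately show ?thesis
      by (simp add: algebra_simps)
  qed
  with add scale have "bounded_linear \<pi>"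
    by (intro bounded_linear_intro)
  then show ?thesis
    using that \<pi> uniq by blast
qed

lemma finite_dim_subspace:
  fixes V W :: "'a::real_vector set"
  assumes "finite_dim W" "subspace V" "V \<subseteq> W"
  shows "finite_dim V"
proof -
  obtain B where B: "finite B" "W = span B"
    using assms(1) by (auto simp: finite_dim_def)
  obtain A where A: "A \<subseteq> V" "independent A" "V \<subseteq> span A"
    using maximal_independent_subset by blast
  have "finite A"
    using independent_span_bound[OF B(1) A(2)] A(1) assms(3) B(2) by blast
  moreover have "V = span A"
    using A span_minimal[OF A(1) assms(2)] by blast
  ultimately show ?thesis
    by (auto simp: finite_dim_def)
qed

section \<open>Affine maps are smooth\<close>

text \<open>The first derivative of an affine map is constant and the higher ones vanish. The witnesses
  for the derivatives are given by the affine formula everywhere, since the values of \<open>f\<close> outside \<open>S\<close> are arbitrary.\<close>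

lemma smooth_on_affine:
  fixes f :: "'a::real_normed_vector \<Rightarrow> 'b::real_normed_vector"
  assumes S: "open S" and L: "bounded_linear L" and f: "\<And>x. x \<in> S \<Longrightarrow> f x = c + L x"
  shows "smooth_on S f"
proof -
  interpret bounded_linear L
    by (rule L)
  define D :: "nat \<Rightarrow> 'a \<Rightarrow> 'a list \<Rightarrow> 'b" where
    "D k x vs = (if k = 0 then c + L x else if k = 1 then L (hd vs) else 0)" for k x vs
  obtain K where K: "\<And>x. norm (L x) \<le> norm x * K"
    using bounded by blast
  have "bounded_multilinear k (D k x)" for k x
    unfolding bounded_multilinear_def
  proof (intro conjI allI impI)
    fix vs :: "'a list" and i
    assume "length vs = k" "i < k"
    then show "linear (\<lambda>u. D k x (vs[i := u]))"
      by (cases "k = 1") (auto simp: D_def length_Suc_conv linear_axioms linear_zero module_hom_zero)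
  next
    consider "k = 0" | "k = 1" | "k \<ge> 2"
      by linarith
    then show "\<exists>C. \<forall>vs. length vs = k \<longrightarrow> norm (D k x vs) \<le> C * prod_list (map norm vs)"
    proof cases
      case 1
      then show ?thesis
        by (auto simp: D_def)
    next
      case 2
      then show ?thesis
        using K by (auto simp: D_def length_Suc_conv mult.commute intro!: exI[of _ K])
    next
      case 3
      then show ?thesis
        by (auto simp: D_def intro!: exI[of _ 0])
    qed
  qed
  moreover have "norm (D k y vs - D k x vs - D (Suc k) x ((y - x) # vs)) = 0" for k x y vs
    by (cases "k = 0") (auto simp: D_def diff)
  moreover have "0 \<le> prod_list (map norm vs)" for vs :: "'a list"
    by (induction vs) auto
  moreover have "D 0 x [] = f x" if "x \<in> S" for x
    using f[OF that] by (simp add: D_def)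
  ultimately show ?thesis
    unfolding smooth_on_def using S
    by (intro conjI exI[of _ D] ballI allI impI always_eventually) simp_all
qed

section \<open>Approximating the identity by maps with locally finite-dimensional range\<close>

text \<open>The rational linear combinations of a finite spanning set.\<close>

lemma finite_dim_countable_dense:
  fixes F :: "'a::real_normed_vector set"
  assumes "finite_dim F"
  shows "\<exists>D. countable D \<and> D \<subseteq> F \<and> F \<subseteq> closure D"
proof -
  obtain B where B: "finite B" "F = span B"
    using assms by (auto simp: finite_dim_def)
  from B(1) have "\<exists>D. countable D \<and> D \<subseteq> span B \<and> span B \<subseteq> closure D"
  proof induction
    case empty
    show ?case
      by (intro exI[of _ "{0}"]) simp
  next
    case (insert b B)
    then obtain D where D: "countable D" "D \<subseteq> span B" "span B \<subseteq> closure D"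
      by blast
    let ?c = "\<lambda>p. fst p *\<^sub>R b + snd p"
    have "span (insert b B) \<subseteq> closure (?c ` (\<rat> \<times> D))"
    proof
      fix x
      assume "x \<in> span (insert b B)"
      then obtain k where "x - k *\<^sub>R b \<in> span B"
        by (auto simp: span_insert)
      then have "(k, x - k *\<^sub>R b) \<in> closure (\<rat> \<times> D)"
        using D(3) by (auto simp: closure_Times Rats_closure_real)
      moreover have "?c ` closure (\<rat> \<times> D) \<subseteq> closure (?c ` (\<rat> \<times> D))"
        by (intro image_closure_subset closure_subset closed_closure continuous_intros)
      ultimately show "x \<in> closure (?c ` (\<rat> \<times> D))"
        by force
    qed
    moreover have "?c ` (\<rat> \<times> D) \<subseteq> span (insert b B)"
    proof -
      have "D \<subseteq> span (insert b B)" "b \<in> span (insert b B)"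
        using D(2) span_mono[of B "insert b B"] by (auto intro: span_base)
      then show ?thesis
        by (auto intro!: span_add span_scale)
    qed
    moreover have "countable (?c ` (\<rat> \<times> D))"
      using D(1) countable_rat by blast
    ultimately show ?case
      by blast
  qed
  then show ?thesis
    using B by simp
qed

lemma dense_sequence_in_Union:
  fixes F :: "nat \<Rightarrow> 'a::real_normed_vector set"
  assumes F: "\<And>n. n \<in> I \<Longrightarrow> finite_dim (F n)" and dense: "closure (\<Union>n\<in>I. F n) = UNIV"
  obtains d :: "nat \<Rightarrow> 'a" where "range d \<subseteq> (\<Union>n\<in>I. F n)" "closure (range d) = UNIV"
proof -
  have "\<forall>n\<in>I. \<exists>D. countable D \<and> D \<subseteq> F n \<and> F n \<subseteq> closure D"
    using F finite_dim_countable_dense by blast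
  then obtain D where D: "\<And>n. n \<in> I \<Longrightarrow> countable (D n) \<and> D n \<subseteq> F n \<and> F n \<subseteq> closure (D n)"
    by metis
  let ?D = "\<Union>n\<in>I. D n"
  have "(\<Union>n\<in>I. F n) \<subseteq> closure ?D"
  proof (rule UN_least)
    fix n assume n: "n \<in> I"
    then have "closure (D n) \<subseteq> closure ?D"
      by (intro closure_mono) blast
    then show "F n \<subseteq> closure ?D"
      using D[OF n] by blast
  qed
  then have "closure (\<Union>n\<in>I. F n) \<subseteq> closure ?D"
    by (intro closure_minimal) simp_all
  then have cl: "closure ?D = UNIV"
    using dense by blast
  then have "?D \<noteq> {}"
    using closure_empty by fastforce
  moreover have "countable ?D"
    using D by blast
  ultimately have "range (from_nat_into ?D) = ?D"
    by (rule range_from_nat_into)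
  moreover have "?D \<subseteq> (\<Union>n\<in>I. F n)"
    using D by blast
  ultimately show ?thesis
    using that[of "from_nat_into ?D"] cl by simp
qed

text \<open>A partition of unity on \<open>U\<close>, indexed by the points of the dense sequence, is made without
  appeal to paracompactness. The bump \<open>\<mu> i\<close> lives on the points \<open>x\<close> for which \<open>d i\<close> lies in a ball
  around \<open>x\<close> inside \<open>U\<close>. These bumps cover \<open>U\<close> but are not locally finite. Subtracting
  \<open>i\<close> times the sum of all earlier bumps repairs this: where some \<open>\<mu> k\<close> exceeds \<open>c\<close>, the
  bumps with \<open>i > k\<close> and \<open>i * c > 1\<close> are cut off, while the first positive bump at a point
  survives unchanged.\<close>

lemma dense_sequence_approximates_identity:
  fixes U :: "'a::real_normed_vector set" and d :: "nat \<Rightarrow> 'a"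
  assumes U: "open U" and d: "closure (range d) = UNIV"
  obtains g where "continuous_on U g" "\<And>x. x \<in> U \<Longrightarrow> closed_segment x (g x) \<subseteq> U"
    "\<And>x. x \<in> U \<Longrightarrow> \<exists>G N. open G \<and> x \<in> G \<and> g ` G \<subseteq> span (d ` {..<N})"
proof -
  \<comment> \<open>A continuous radius such that the ball around \<open>x \<in> U\<close> lies in \<open>U\<close>. The bound by \<open>1\<close> keeps the bumps \<open>\<mu> i\<close>
    below \<open>1\<close>; the case distinction is there because \<^const>\<open>infdist\<close> from the empty set is \<open>0\<close>.\<close>
  define \<rho> where "\<rho> x = (if U = UNIV then 1 else min 1 (infdist x (- U)))" for x
  have \<rho>_cont: "continuous_on UNIV \<rho>"
    unfolding \<rho>_def by (cases "U = UNIV") (auto intro!: continuous_intros)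
  have \<rho>_le: "\<rho> x \<le> 1" for x
    by (simp add: \<rho>_def)
  have \<rho>_pos: "\<rho> x > 0" if "x \<in> U" for x
    using that U infdist_pos_not_in_closed[of "- U" x] by (auto simp: \<rho>_def)
  have \<rho>_ball: "ball x (\<rho> x) \<subseteq> U" if "x \<in> U" for x
  proof
    fix y
    assume y: "y \<in> ball x (\<rho> x)"
    show "y \<in> U"
    proof (rule ccontr)
      assume "y \<notin> U"
      then have "U \<noteq> UNIV" "infdist x (- U) \<le> dist x y"
        by (auto intro: infdist_le)
      then show False
        using y by (simp add: \<rho>_def)
    qed
  qed
  define \<mu> where "\<mu> i x = max 0 (\<rho> x - dist x (d i))" for i x
  define w where "w i x = max 0 (\<mu> i x - real i * (\<Sum>j<i. \<mu> j x))" for i x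
  have \<mu>_cont: "continuous_on UNIV (\<mu> i)" for i
    unfolding \<mu>_def using \<rho>_cont by (intro continuous_intros) auto
  have w_cont: "continuous_on UNIV (w i)" for i
    unfolding w_def using \<mu>_cont by (intro continuous_intros) auto
  have \<mu>_nonneg: "\<mu> i x \<ge> 0" and w_nonneg: "w i x \<ge> 0" for i x
    by (simp_all add: \<mu>_def w_def)
  have \<mu>_le: "\<mu> i x \<le> 1" for i x
    using \<rho>_le[of x] zero_le_dist[of x "d i"] by (simp add: \<mu>_def max_def del: zero_le_dist)
  have w_near: "d i \<in> ball x (\<rho> x)" if "w i x \<noteq> 0" for i x
  proof -
    have "0 \<le> real i * (\<Sum>j<i. \<mu> j x)"
      using \<mu>_nonneg by (simp add: sum_nonneg)
    then have "\<mu> i x \<noteq> 0"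
      using that unfolding w_def by linarith
    then show ?thesis
      by (auto simp: \<mu>_def max_def split: if_splits)
  qed
  have \<mu>_ex: "\<exists>i. \<mu> i x > 0" if x: "x \<in> U" for x
  proof -
    have "x \<in> closure (range d)"
      by (simp add: d)
    then obtain i where "dist (d i) x < \<rho> x"
      using \<rho>_pos[OF x] unfolding closure_approachable by blast
    then show ?thesis
      by (auto simp: \<mu>_def dist_commute intro!: exI[of _ i])
  qed
  have w_ex: "\<exists>i. w i x > 0" if x: "x \<in> U" for x
  proof -
    \<comment> \<open>The first positive bump has nothing subtracted from it.\<close>
    define i where "i = (LEAST i. \<mu> i x > 0)"
    have i: "\<mu> i x > 0"
      unfolding i_def using \<mu>_ex[OF x] by (rule LeastI_ex)
    have "\<mu> j x = 0" if "j < i" for j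
      using not_less_Least[of j "\<lambda>i. \<mu> i x > 0"] that \<mu>_nonneg[of j x] by (simp add: i_def)
    then have "w i x = \<mu> i x"
      using i by (simp add: w_def)
    then show ?thesis
      using i by (intro exI[of _ i]) simp
  qed
  have locfin: "\<exists>G N. open G \<and> x \<in> G \<and> (\<forall>y\<in>G. \<forall>i\<ge>N. w i y = 0)" if x: "x \<in> U" for x
  proof -
    obtain k where k: "\<mu> k x > 0"
      using \<mu>_ex[OF x] by blast
    define c where "c = \<mu> k x / 2"
    define G where "G = {y. c < \<mu> k y}"
    have "c > 0"
      using k by (simp add: c_def)
    then obtain N0 :: nat where N0: "real N0 * c > 1"
      using reals_Archimedean3 by blast
    have "w i y = 0" if y: "y \<in> G" and i: "i \<ge> max N0 (Suc k)" for y i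
    proof -
      have "1 \<le> real N0 * c"
        using N0 by simp
      also have "\<dots> \<le> real i * c"
        using i k by (intro mult_right_mono) (auto simp: c_def)
      also have "\<dots> \<le> real i * \<mu> k y"
        using y by (intro mult_left_mono) (auto simp: G_def)
      also have "\<dots> \<le> real i * (\<Sum>j<i. \<mu> j y)"
        using i \<mu>_nonneg by (intro mult_left_mono member_le_sum) auto
      finally show ?thesis
        using \<mu>_le[of i y] by (simp add: w_def)
    qed
    moreover have "open G"
      unfolding G_def using \<mu>_cont by (intro open_Collect_less) auto
    moreover have "x \<in> G"
      using k by (simp add: G_def c_def)
    ultimately show ?thesis
      by blast
  qed
  define S where "S x = (\<Sum>i | w i x \<noteq> 0. w i x)" for x
  define g where "g x = (\<Sum>i | w i x \<noteq> 0. (w i x / S x) *\<^sub>R d i)" for x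
  have S_eq: "S x = (\<Sum>i<N. w i x)" and g_eq: "g x = (\<Sum>i<N. (w i x / S x) *\<^sub>R d i)"
    if "\<forall>i\<ge>N. w i x = 0" for x N
  proof -
    have "{i. w i x \<noteq> 0} \<subseteq> {..<N}"
      using that not_less by (auto simp flip: not_le)
    then show "S x = (\<Sum>i<N. w i x)" "g x = (\<Sum>i<N. (w i x / S x) *\<^sub>R d i)"
      unfolding S_def g_def by (auto intro!: sum.mono_neutral_left)
  qed
  have fin: "finite {i. w i x \<noteq> 0}" if x: "x \<in> U" for x
  proof -
    obtain N where "\<forall>i\<ge>N. w i x = 0"
      using locfin[OF x] by blast
    then have "{i. w i x \<noteq> 0} \<subseteq> {..<N}"
      by (auto simp flip: not_le)
    then show ?thesis
      using finite_subset by blast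
  qed
  have S_pos: "S x > 0" if x: "x \<in> U" for x
  proof -
    obtain i where "w i x > 0"
      using w_ex[OF x] by blast
    then show ?thesis
      unfolding S_def using fin[OF x] w_nonneg by (intro sum_pos2[of _ i]) auto
  qed
  have g_ball: "g x \<in> ball x (\<rho> x)" if x: "x \<in> U" for x
    unfolding g_def
  proof (rule convex_sum)
    show "(\<Sum>i | w i x \<noteq> 0. w i x / S x) = 1"
      using S_pos[OF x] by (simp add: S_def flip: sum_divide_distrib)
    show "0 \<le> w i x / S x" for i
      using S_pos[OF x] w_nonneg by simp
  qed (use fin[OF x] w_near in auto)
  show ?thesis
  proof (rule that)
    show "continuous_on U g"
    proof (rule continuous_at_imp_continuous_on, rule ballI)
      fix x
      assume x: "x \<in> U"
      obtain G N where G: "open G" "x \<in> G" "\<And>y. y \<in> G \<Longrightarrow> \<forall>i\<ge>N. w i y = 0"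
        using locfin[OF x] by meson
      let ?g = "\<lambda>y. \<Sum>i<N. (w i y / (\<Sum>i<N. w i y)) *\<^sub>R d i"
      have "isCont (w i) x" for i
        using w_cont continuous_on_eq_continuous_at by blast
      moreover have "(\<Sum>i<N. w i x) \<noteq> 0"
        using S_pos[OF x] S_eq[OF G(3)[OF G(2)]] by simp
      ultimately have "isCont ?g x"
        by (intro continuous_intros) auto
      moreover have "\<forall>\<^sub>F y in nhds x. g y = ?g y"
        unfolding eventually_nhds using G S_eq g_eq by (intro exI[of _ G]) auto
      ultimately show "isCont g x"
        by (rule isCont_cong[THEN iffD2, rotated])
    qed
    show "closed_segment x (g x) \<subseteq> U" if x: "x \<in> U" for x
    proof -
      have "closed_segment x (g x) \<subseteq> ball x (\<rho> x)"
        using g_ball[OF x] \<rho>_pos[OF x] by (intro closed_segment_subset) auto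
      then show ?thesis
        using \<rho>_ball[OF x] by blast
    qed
    show "\<exists>G N. open G \<and> x \<in> G \<and> g ` G \<subseteq> span (d ` {..<N})" if x: "x \<in> U" for x
    proof -
      obtain G N where G: "open G" "x \<in> G" "\<And>y. y \<in> G \<Longrightarrow> \<forall>i\<ge>N. w i y = 0"
        using locfin[OF x] by meson
      have "g y \<in> span (d ` {..<N})" if "y \<in> G" for y
        using g_eq[OF G(3)[OF that]] by (auto intro!: span_sum span_scale intro: span_base)
      with G show ?thesis
        by blast
    qed
  qed
qed

section \<open>The inductive limit topology\<close>

lemma topspace_inductive_limit:
  assumes "\<And>n. n \<ge> 1 \<Longrightarrow> N n \<subseteq> topspace T"
  shows "topspace (inductive_limit_topology T N) = (\<Union>n\<in>{1..}. N n)"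
proof
  show "topspace (inductive_limit_topology T N) \<subseteq> (\<Union>n\<in>{1..}. N n)"
    using openin_topspace[of "inductive_limit_topology T N"]
    unfolding openin_inductive_limit_topology by blast
  have "openin (inductive_limit_topology T N) (\<Union>n\<in>{1..}. N n)"
    unfolding openin_inductive_limit_topology
  proof (intro conjI allI impI order_refl)
    fix n :: nat
    assume n: "n \<ge> 1"
    then have "(\<Union>n\<in>{1..}. N n) \<inter> N n = N n"
      by auto
    then show "openin (subtopology T (N n)) ((\<Union>n\<in>{1..}. N n) \<inter> N n)"
      using assms[OF n] by (metis openin_topspace topspace_subtopology_subset)
  qed
  then show "(\<Union>n\<in>{1..}. N n) \<subseteq> topspace (inductive_limit_topology T N)"
    by (rule openin_subset)
qed

lemma continuous_map_inductive_limit_id: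
  "continuous_map (inductive_limit_topology T N) T id"
  unfolding continuous_map_def
proof (intro conjI allI impI)
  let ?L = "inductive_limit_topology T N"
  have sub: "topspace ?L \<subseteq> (\<Union>n\<in>{1..}. N n)"
    and opn: "\<And>n. n \<ge> 1 \<Longrightarrow> openin (subtopology T (N n)) (topspace ?L \<inter> N n)"
    using openin_topspace[of ?L] unfolding openin_inductive_limit_topology by blast+
  have "x \<in> topspace T" if x: "x \<in> topspace ?L" for x
  proof -
    obtain n where "n \<ge> 1" "x \<in> N n"
      using x sub by fastforce
    then show ?thesis
      using openin_subset[OF opn] x by fastforce
  qed
  then show "id \<in> topspace ?L \<rightarrow> topspace T"
    by simp
  fix U assume U: "openin T U"
  have "openin (subtopology T (N n)) ({x \<in> topspace ?L. id x \<in> U} \<inter> N n)" if n: "n \<ge> 1" for n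
  proof -
    have "openin (subtopology T (N n)) ((topspace ?L \<inter> N n) \<inter> (U \<inter> N n))"
      by (rule openin_Int[OF opn[OF n] openin_subtopology_Int[OF U]])
    moreover have "(topspace ?L \<inter> N n) \<inter> (U \<inter> N n) = {x \<in> topspace ?L. id x \<in> U} \<inter> N n"
      by auto
    ultimately show ?thesis
      by simp
  qed
  then show "openin ?L {x \<in> topspace ?L. id x \<in> U}"
    unfolding openin_inductive_limit_topology using sub by blast
qed

text \<open>The inductive limit topology is finer than the one induced by \<open>T\<close>, but both induce the same topology on each \<open>N n\<close>;
  so it is enough that \<open>f\<close> maps into a single \<open>N n\<close> near every point.\<close>

lemma continuous_map_into_inductive_limit:
  assumes f: "continuous_map X T f"
    and loc: "\<And>x. x \<in> topspace X \<Longrightarrow> \<exists>G n. openin X G \<and> x \<in> G \<and> n \<ge> 1 \<and> f ` G \<subseteq> N n"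
    and N: "\<And>n. n \<ge> 1 \<Longrightarrow> N n \<subseteq> topspace T"
  shows "continuous_map X (inductive_limit_topology T N) f"
  unfolding continuous_map_def
proof (intro conjI allI impI)
  show "f \<in> topspace X \<rightarrow> topspace (inductive_limit_topology T N)"
  proof
    have topL: "topspace (inductive_limit_topology T N) = (\<Union>n\<in>{1..}. N n)"
      by (rule topspace_inductive_limit[OF N])
    fix x assume "x \<in> topspace X"
    then obtain G n where "x \<in> G" "n \<ge> 1" "f ` G \<subseteq> N n"
      using loc by blast
    then show "f x \<in> topspace (inductive_limit_topology T N)"
      unfolding topL by auto
  qed
  fix U assume U: "openin (inductive_limit_topology T N) U"
  show "openin X {x \<in> topspace X. f x \<in> U}"
  proof (subst openin_subopen, rule ballI)
    fix x assume x: "x \<in> {x \<in> topspace X. f x \<in> U}"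
    then obtain G n where G: "openin X G" "x \<in> G" "n \<ge> 1" "f ` G \<subseteq> N n"
      using loc by blast
    then obtain U' where U': "openin T U'" "U \<inter> N n = U' \<inter> N n"
      using U unfolding openin_inductive_limit_topology openin_subtopology by blast
    have "openin X (G \<inter> {x \<in> topspace X. f x \<in> U'})"
      using G(1) openin_continuous_map_preimage[OF f U'(1)] by blast
    moreover have "x \<in> G \<inter> {x \<in> topspace X. f x \<in> U'}"
      using x G U' by auto
    moreover have "G \<inter> {x \<in> topspace X. f x \<in> U'} \<subseteq> {x \<in> topspace X. f x \<in> U}"
      using G U' by auto
    ultimately show "\<exists>V. openin X V \<and> x \<in> V \<and> V \<subseteq> {x \<in> topspace X. f x \<in> U}"
      by blast
  qed
qed

text \<open>In general a product with an inductive limit need not be the inductive limit of the products.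
  Local compactness of \<open>X\<close> saves this: around \<open>(t, x)\<close> take a compact neighbourhood \<open>K\<close> of \<open>t\<close> with \<open>K \<times> {x}\<close> mapped
  into \<open>U\<close>. The set of all \<open>y\<close> with \<open>K \<times> {y}\<close> mapped into \<open>U\<close> meets every \<open>N n\<close> in an open set,
  by the tube lemma.\<close>

lemma continuous_map_prod_inductive_limit:
  assumes X: "neighbourhood_base_of (compactin X) X"
    and N: "\<And>n. n \<ge> 1 \<Longrightarrow> N n \<subseteq> topspace T"
    and h: "\<And>n. n \<ge> 1 \<Longrightarrow> continuous_map (prod_topology X (subtopology T (N n))) Y h"
  shows "continuous_map (prod_topology X (inductive_limit_topology T N)) Y h"
  unfolding continuous_map_def
proof (intro conjI allI impI)
  let ?L = "inductive_limit_topology T N"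
  have topL: "topspace ?L = (\<Union>n\<in>{1..}. N n)"
    by (rule topspace_inductive_limit[OF N])
  have topN: "topspace (subtopology T (N n)) = N n" if "n \<ge> 1" for n
    using N[OF that] by auto
  have hY: "h (s, y) \<in> topspace Y" if "n \<ge> 1" "s \<in> topspace X" "y \<in> N n" for n s y
    using continuous_map_image_subset_topspace[OF h[OF that(1)]] that topN[OF that(1)] by auto
  then show "h \<in> topspace (prod_topology X ?L) \<rightarrow> topspace Y"
    by (auto simp: topL)
  fix U assume U: "openin Y U"
  have pre: "openin (prod_topology X (subtopology T (N n))) {p \<in> topspace X \<times> N n. h p \<in> U}"
    if "n \<ge> 1" for n
    using openin_continuous_map_preimage[OF h[OF that] U] topN[OF that] by simp
  show "openin (prod_topology X ?L) {p \<in> topspace (prod_topology X ?L). h p \<in> U}"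
    unfolding openin_prod_topology_alt
  proof (intro allI impI)
    fix t x
    assume "(t, x) \<in> {p \<in> topspace (prod_topology X ?L). h p \<in> U}"
    then obtain m where m: "m \<ge> 1" "x \<in> N m" and t: "t \<in> topspace X" "h (t, x) \<in> U"
      by (auto simp: topL)
    have "continuous_map X Y (h \<circ> (\<lambda>s. (s, x)))"
      using m topN[OF m(1)]
      by (intro continuous_map_compose[OF _ h[OF m(1)]] continuous_intros) auto
    from openin_continuous_map_preimage[OF this U]
    have "openin X {s \<in> topspace X. h (s, x) \<in> U} \<and> t \<in> {s \<in> topspace X. h (s, x) \<in> U}"
      using t by simp
    from X[unfolded neighbourhood_base_of, rule_format, OF this]
    obtain J K where J: "openin X J" "t \<in> J" "J \<subseteq> K" and K: "compactin X K"
      and Kx: "K \<subseteq> {s \<in> topspace X. h (s, x) \<in> U}"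
      by blast
    have KX: "K \<subseteq> topspace X"
      using K compactin_subset_topspace by blast
    define V where "V = {y \<in> \<Union>n\<in>{1..}. N n. \<forall>s\<in>K. h (s, y) \<in> U}"
    have "openin (subtopology T (N n)) (V \<inter> N n)" if n: "n \<ge> 1" for n
    proof (subst openin_subopen, rule ballI)
      fix y assume y: "y \<in> V \<inter> N n"
      have yc: "compactin (subtopology T (N n)) {y}"
        using y topN[OF n] by (simp add: compactin_sing)
      have sub: "K \<times> {y} \<subseteq> {p \<in> topspace X \<times> N n. h p \<in> U}"
        using y KX by (auto simp: V_def)
      obtain A B where AB: "openin X A" "openin (subtopology T (N n)) B" "K \<subseteq> A" "{y} \<subseteq> B"
          "A \<times> B \<subseteq> {p \<in> topspace X \<times> N n. h p \<in> U}"
        by (rule Wallace_theorem_prod_topology[OF K yc pre[OF n] sub])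
      have "B \<subseteq> N n"
        using openin_subset[OF AB(2)] topN[OF n] by simp
      then have "B \<subseteq> V \<inter> N n"
        using AB(3,5) n by (auto simp: V_def)
      with AB show "\<exists>B. openin (subtopology T (N n)) B \<and> y \<in> B \<and> B \<subseteq> V \<inter> N n"
        by blast
    qed
    then have "openin ?L V"
      unfolding openin_inductive_limit_topology by (auto simp: V_def)
    moreover have "x \<in> V"
      using m Kx by (auto simp: V_def)
    moreover have "J \<times> V \<subseteq> {p \<in> topspace (prod_topology X ?L). h p \<in> U}"
      using J(3) KX by (auto simp: V_def topL)
    ultimately show "\<exists>A B. openin X A \<and> openin ?L B \<and> t \<in> A \<and> x \<in> B \<and>
        A \<times> B \<subseteq> {p \<in> topspace (prod_topology X ?L). h p \<in> U}"
      using J by blast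
  qed
qed

lemma neighbourhood_base_of_compactin_interval:
  "neighbourhood_base_of (compactin (top_of_set {a..b::real})) (top_of_set {a..b})"
proof (subst locally_compact_space_neighbourhood_base[symmetric])
  show "Hausdorff_space (top_of_set {a..b}) \<or> regular_space (top_of_set {a..b})"
    by (simp add: Hausdorff_space_subtopology)
  show "locally_compact_space (top_of_set {a..b})"
    by (intro compact_imp_locally_compact_space) (simp add: compact_space_subtopology)
qed

lemma nested_sequence_mono:
  fixes F :: "nat \<Rightarrow> 'a set"
  assumes "\<And>n. n \<ge> 1 \<Longrightarrow> F n \<subseteq> F (Suc n)" "1 \<le> m" "m \<le> n"
  shows "F m \<subseteq> F n"
  using assms(3,2)
proof (induction rule: dec_induct)
  case (step n)
  then show ?case
    using assms(1)[of n] by simp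
qed simp

text \<open>The inclusion has the homotopy inverse \<open>k\<close>, which is \<open>g\<close> read in the chart. Near a point, \<open>g\<close>
  takes values in one \<open>F n\<close>, so on \<open>N m\<close> the straight-line homotopy stays locally in \<open>F (max m n)\<close>;
  this is what makes it continuous for the inductive limit topology.\<close>

theorem homotopy_equivalence_inductive_limit:
  fixes \<phi> :: "'x \<Rightarrow> 'p::real_normed_vector"
  assumes \<phi>: "homeomorphic_map T (top_of_set U) \<phi>" and U: "open U"
    and F: "\<And>n. n \<ge> 1 \<Longrightarrow> subspace (F n)" "\<And>n. n \<ge> 1 \<Longrightarrow> finite_dim (F n)"
      "\<And>n. n \<ge> 1 \<Longrightarrow> F n \<subseteq> F (Suc n)" "closure (\<Union>n\<in>{1..}. F n) = UNIV"
    and N: "\<And>n. n \<ge> 1 \<Longrightarrow> N n = {x \<in> topspace T. \<phi> x \<in> F n}"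
  shows "homotopy_equivalence (inductive_limit_topology T N) T id"
proof -
  let ?L = "inductive_limit_topology T N" and ?I = "top_of_set {0..1::real}"
  have NT: "N n \<subseteq> topspace T" if "n \<ge> 1" for n
    using N[OF that] by auto
  have topL: "topspace ?L = (\<Union>n\<in>{1..}. N n)"
    by (rule topspace_inductive_limit[OF NT])
  obtain \<psi> where \<psi>: "homeomorphic_maps T (top_of_set U) \<phi> \<psi>"
    using \<phi> homeomorphic_map_maps by blast
  then have \<phi>_cont: "continuous_map T (top_of_set U) \<phi>" and \<psi>_cont: "continuous_map (top_of_set U) T \<psi>"
    and \<psi>\<phi>: "\<And>x. x \<in> topspace T \<Longrightarrow> \<psi> (\<phi> x) = x" and \<phi>\<psi>: "\<And>y. y \<in> U \<Longrightarrow> \<phi> (\<psi> y) = y"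
    by (auto simp: homeomorphic_maps_def)
  have \<phi>_in: "\<phi> x \<in> U" if "x \<in> topspace T" for x
    using continuous_map_image_subset_topspace[OF \<phi>_cont] that by auto
  have \<psi>_in: "\<psi> y \<in> topspace T" if "y \<in> U" for y
    using continuous_map_image_subset_topspace[OF \<psi>_cont] that by auto
  obtain d :: "nat \<Rightarrow> 'p" where d: "range d \<subseteq> (\<Union>n\<in>{1..}. F n)" "closure (range d) = UNIV"
    using dense_sequence_in_Union[of "{1..}" F] F(2,4) by auto
  have span_d: "\<exists>n\<ge>1. span (d ` {..<k}) \<subseteq> F n" for k
  proof -
    have "\<exists>n\<ge>1. d ` {..<k} \<subseteq> F n"
    proof (induction k)
      case (Suc k)
      obtain n where n: "n \<ge> 1" "d ` {..<k} \<subseteq> F n"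
        using Suc by blast
      obtain m where m: "m \<ge> 1" "d k \<in> F m"
        using d(1) by fastforce
      have "F n \<subseteq> F (max n m)" "F m \<subseteq> F (max n m)"
        using n(1) m(1) F(3) nested_sequence_mono[of F] by (simp_all add: max.coboundedI1)
      then show ?case
        using n m by (intro exI[of _ "max n m"]) (auto simp: lessThan_Suc)
    qed auto
    then show ?thesis
      using F(1) span_minimal by blast
  qed
  obtain g where g_cont: "continuous_on U g" and g_seg: "\<And>y. y \<in> U \<Longrightarrow> closed_segment y (g y) \<subseteq> U"
    and g_loc: "\<And>y. y \<in> U \<Longrightarrow> \<exists>G k. open G \<and> y \<in> G \<and> g ` G \<subseteq> span (d ` {..<k})"
    using dense_sequence_approximates_identity[OF U d(2)] by blast
  have gT: "\<exists>G n. openin T G \<and> x \<in> G \<and> n \<ge> 1 \<and> (\<forall>y\<in>G. g (\<phi> y) \<in> F n)" if x: "x \<in> topspace T" for x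
  proof -
    obtain G k where G: "open G" "\<phi> x \<in> G" "g ` G \<subseteq> span (d ` {..<k})"
      using g_loc[OF \<phi>_in[OF x]] by blast
    obtain n where n: "n \<ge> 1" "span (d ` {..<k}) \<subseteq> F n"
      using span_d by blast
    have "continuous_map T euclidean \<phi>"
      using \<phi>_cont continuous_map_into_fulltopology by blast
    then have "openin T {y \<in> topspace T. \<phi> y \<in> G}"
      using G(1) openin_continuous_map_preimage by fastforce
    then show ?thesis
      using G n x by (intro exI[of _ "{y \<in> topspace T. \<phi> y \<in> G}"] exI[of _ n]) auto
  qed
  define q where "q = (\<lambda>(t, y). (1 - t) *\<^sub>R y + t *\<^sub>R g y)"
  define h where "h = (\<lambda>(t, x). \<psi> (q (t, \<phi> x)))"
  have q_in: "q (t, y) \<in> U" if "t \<in> {0..1}" "y \<in> U" for t y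
    using g_seg[OF that(2)] that(1) by (auto simp: q_def closed_segment_def)
  have \<phi>h: "\<phi> (h (t, x)) = q (t, \<phi> x)" and h_in: "h (t, x) \<in> topspace T"
    if "t \<in> {0..1}" "x \<in> topspace T" for t x
    using q_in[OF that(1) \<phi>_in[OF that(2)]] \<phi>\<psi> \<psi>_in by (auto simp: h_def)
  have h0: "h (0, x) = x" if "x \<in> topspace T" for x
    using \<psi>\<phi>[OF that] by (simp add: h_def q_def)
  have h_cont: "continuous_map (prod_topology ?I T) T h"
  proof -
    have "continuous_on ({0..1} \<times> U) q"
      unfolding q_def case_prod_unfold
      by (intro continuous_intros continuous_on_compose2[OF g_cont]) auto
    then have "continuous_map (top_of_set ({0..1} \<times> U)) (top_of_set U) q"
      using q_in by auto
    then have "continuous_map (prod_topology ?I (top_of_set U)) (top_of_set U) q"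
      by (simp flip: subtopology_Times euclidean_product_topology)
    moreover have "continuous_map (prod_topology ?I T) (prod_topology ?I (top_of_set U)) (\<lambda>p. (fst p, \<phi> (snd p)))"
      by (intro continuous_map_pairedI continuous_map_fst
          continuous_map_compose[OF continuous_map_snd \<phi>_cont, unfolded o_def])
    ultimately have "continuous_map (prod_topology ?I T) T (\<psi> \<circ> (q \<circ> (\<lambda>p. (fst p, \<phi> (snd p)))))"
      using \<psi>_cont by (blast intro: continuous_map_compose)
    then show ?thesis
      by (simp add: h_def o_def case_prod_unfold)
  qed
  define k where "k = (\<lambda>x. h (1, x))"
  have "continuous_map T T (h \<circ> (\<lambda>x. (1, x)))"
    by (intro continuous_map_compose[OF _ h_cont] continuous_map_pairedI) auto
  then have k_cont: "continuous_map T T k"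
    by (simp add: k_def o_def)
  have k_L: "continuous_map T ?L k"
  proof (rule continuous_map_into_inductive_limit[OF k_cont _ NT])
    fix x assume "x \<in> topspace T"
    then obtain G n where G: "openin T G" "x \<in> G" "n \<ge> 1" "\<And>y. y \<in> G \<Longrightarrow> g (\<phi> y) \<in> F n"
      using gT by meson
    have "k y \<in> N n" if "y \<in> G" for y
      using openin_subset[OF G(1)] G(3,4) that h_in[of 1 y] \<phi>h[of 1 y] N[of n]
      by (auto simp: k_def q_def)
    with G show "\<exists>G n. openin T G \<and> x \<in> G \<and> n \<ge> 1 \<and> k ` G \<subseteq> N n"
      by blast
  qed
  have h_L: "continuous_map (prod_topology ?I ?L) ?L h"
  proof (rule continuous_map_prod_inductive_limit[OF neighbourhood_base_of_compactin_interval NT])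
    fix m :: nat
    assume m: "m \<ge> 1"
    have topm: "topspace (subtopology T (N m)) = N m"
      using NT[OF m] by auto
    show "continuous_map (prod_topology ?I (subtopology T (N m))) ?L h"
    proof (rule continuous_map_into_inductive_limit[OF _ _ NT])
      show "continuous_map (prod_topology ?I (subtopology T (N m))) T h"
        using h_cont by (simp add: prod_topology_subtopology(2) continuous_map_from_subtopology)
      fix p assume "p \<in> topspace (prod_topology ?I (subtopology T (N m)))"
      then obtain t x where p: "p = (t, x)" "t \<in> {0..1}" "x \<in> N m"
        using topm by auto
      obtain G n where G: "openin T G" "x \<in> G" "n \<ge> 1" "\<And>y. y \<in> G \<Longrightarrow> g (\<phi> y) \<in> F n"
        using gT NT[OF m] p(3) by (meson subsetD)
      let ?n = "max m n"
      have sub: "F m \<subseteq> F ?n" "F n \<subseteq> F ?n"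
        using m G(3) F(3) nested_sequence_mono[of F] by (simp_all add: max.coboundedI1)
      have "h (s, y) \<in> N ?n" if s: "s \<in> {0..1}" and y: "y \<in> G \<inter> N m" for s y
      proof -
        have yT: "y \<in> topspace T"
          using NT[OF m] y by blast
        have "\<phi> y \<in> F ?n" "g (\<phi> y) \<in> F ?n"
          using y G(4) sub N[OF m] by auto
        then have "q (s, \<phi> y) \<in> F ?n"
          using F(1)[of ?n] m by (auto simp: q_def intro!: subspace_add subspace_scale)
        then show ?thesis
          using \<phi>h[OF s yT] h_in[OF s yT] N[of ?n] m by simp
      qed
      then have "h ` ({0..1} \<times> (G \<inter> N m)) \<subseteq> N ?n"
        by auto
      moreover have "openin (prod_topology ?I (subtopology T (N m))) ({0..1} \<times> (G \<inter> N m))"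
        using G(1) by (simp add: openin_prod_Times_iff openin_subtopology_Int)
      ultimately show "\<exists>G n. openin (prod_topology ?I (subtopology T (N m))) G \<and> p \<in> G \<and> 1 \<le> n \<and> h ` G \<subseteq> N n"
        using p G(2) m by (intro exI[of _ "{0..1} \<times> (G \<inter> N m)"] exI[of _ ?n]) auto
    qed
  qed
  have "homotopic_with (\<lambda>_. True) X X id k"
    if "continuous_map (prod_topology ?I X) X h" "topspace X \<subseteq> topspace T" for X
    using that h0 by (subst homotopic_with) (auto simp: k_def intro!: exI[of _ h])
  from this[OF h_L] this[OF h_cont]
  have "homotopic_with (\<lambda>_. True) ?L ?L id k" "homotopic_with (\<lambda>_. True) T T id k"
    using NT by (auto simp: topL)
  then show ?thesis
    unfolding homotopy_equivalence_def
    using k_L continuous_map_inductive_limit_id by (auto simp: homotopic_with_sym intro!: exI[of _ k])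
qed

section \<open>Filtrations of an open subset of a Banach space\<close>

lemma has_dim_span:
  fixes V :: "'a::real_normed_vector set"
  assumes "has_dim V n"
  shows "subspace V" "finite_dim V" "closed V"
proof -
  show "finite_dim V"
    using assms by (simp add: has_dim_def)
  then show "closed V"
    by (rule closed_finite_dim)
  show "subspace V"
    using \<open>finite_dim V\<close> by (auto simp: finite_dim_def)
qed

lemma alg_complement_UNIV_iff: "alg_complement UNIV W \<longleftrightarrow> W = {0}"
proof
  assume "W = {0}"
  then show "alg_complement UNIV W"
    by (auto simp: alg_complement_def subspace_0)
qed (auto simp: alg_complement_def)

lemma finite_dim_singleton_0: "finite_dim {0}"
  unfolding finite_dim_def by (intro exI[of _ "{}"]) simp

lemma fredholm_operator_id: "fredholm_operator (\<lambda>v::'a::real_normed_vector. v)"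
  unfolding fredholm_operator_def
  by (auto simp: alg_complement_UNIV_iff finite_dim_singleton_0 bounded_linear_ident)

lemma fredholm_index_id: "fredholm_index (\<lambda>v::'a::real_normed_vector. v) = 0"
proof -
  have dim0: "dim {0 :: 'a} = 0"
    using dim_span[of "{} :: 'a set"] dim_eq_card_independent[OF independent_empty] by simp
  then have "codim (UNIV :: 'a set) = 0"
    unfolding codim_def
    by (intro the_equality) (auto simp: alg_complement_UNIV_iff has_dim_def finite_dim_singleton_0)
  then show ?thesis
    using dim0 by (simp add: fredholm_index_def)
qed

text \<open>A manifold with one chart, presented by its topology and the chart map; it is the same thing
  as an open subset of the model space.\<close>

locale global_chart =
  fixes T :: "'x topology" and \<phi> :: "'x \<Rightarrow> 'p::banach"
  assumes homeo: "homeomorphic_map T (top_of_set (\<phi> ` topspace T)) \<phi>"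
    and open_image: "open (\<phi> ` topspace T)"
begin

abbreviation chart :: "('x, 'p) chart" where "chart \<equiv> (topspace T, \<phi>)"

lemma inj: "inj_on \<phi> (topspace T)"
  using homeo by (simp add: homeomorphic_eq_everything_map)

lemma chart_inv_chart: "x \<in> topspace T \<Longrightarrow> chart_inv chart (\<phi> x) = x"
  using inj by (simp add: chart_inv_def)

lemma chart_chart_inv: "y \<in> \<phi> ` topspace T \<Longrightarrow> \<phi> (chart_inv chart y) = y"
  by (simp add: chart_inv_def f_inv_into_f)

lemma smooth_on_chart: "smooth_on (\<phi> ` topspace T) (\<phi> \<circ> chart_inv chart)"
  by (rule smooth_on_affine[OF open_image bounded_linear_ident, of _ 0]) (simp add: chart_chart_inv)

lemma is_chart_chart: "is_chart T chart"
  using homeo open_image by (simp add: is_chart_def)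

lemma charts_compatible_chart: "charts_compatible chart chart"
  using smooth_on_chart by (simp add: charts_compatible_def)

lemma smooth_banach_manifold_chart: "smooth_banach_manifold T {chart}"
proof -
  have "T homeomorphic_space top_of_set (\<phi> ` topspace T)"
    using homeo homeomorphic_map_imp_homeomorphic_space by blast
  then have "Hausdorff_space T"
    using homeomorphic_Hausdorff_space by (metis Hausdorff_space_euclidean Hausdorff_space_subtopology)
  then show ?thesis
    by (simp add: smooth_banach_manifold_def is_chart_chart charts_compatible_chart)
qed

lemma chart_deriv_chart:
  assumes x: "x \<in> topspace T"
  shows "chart_deriv chart \<phi> x = (\<lambda>v. v)"
proof -
  have "((\<phi> \<circ> chart_inv chart) has_derivative (\<lambda>v. v)) (at (\<phi> x))"
    by (rule has_derivative_transform_within_open[OF has_derivative_ident open_image])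
      (use x chart_chart_inv in auto)
  from frechet_derivative_at[OF this] show ?thesis
    by (simp add: chart_deriv_def)
qed

lemma fredholm_map_chart: "fredholm_map_index_zero {chart} \<phi>"
  by (simp add: fredholm_map_index_zero_def smooth_map_def smooth_on_chart chart_deriv_chart
      fredholm_operator_id fredholm_index_id)

lemma transverse_chart:
  assumes "closed_complement S W"
  shows "transverse {chart} \<phi> S"
proof -
  have "0 \<in> S"
    using assms by (auto simp: closed_complement_def alg_complement_def)
  then have "{u + s |u s. u \<in> UNIV \<and> s \<in> S} = UNIV"
    by force
  moreover have "\<exists>W. closed_complement ((\<lambda>v. v) -` S) W"
    using assms by auto
  ultimately show ?thesis
    unfolding transverse_def by (simp add: chart_deriv_chart)
qed

text \<open>In the chart the slice is \<open>U \<inter> F\<close>. Difference quotients of curves in \<open>U \<inter> F\<close> lie in \<open>F\<close>, and so do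
  their limits since \<open>F\<close> is closed; conversely every \<open>v \<in> F\<close> is the velocity of a short line segment.\<close>

lemma tangent_space_slice:
  assumes F: "subspace F" "closed F" and x: "x \<in> topspace T" "\<phi> x \<in> F"
    and N: "N = {y \<in> topspace T. \<phi> y \<in> F}"
  shows "tangent_space chart N x = F"
proof -
  have image: "\<phi> ` (topspace T \<inter> N) = \<phi> ` topspace T \<inter> F"
    using N by auto
  have "v \<in> F" if "v \<in> tangent_space chart N x" for v
  proof -
    from that obtain \<gamma> :: "real \<Rightarrow> 'p" and e where \<gamma>: "e > 0" "\<gamma> 0 = \<phi> x"
        "\<gamma> ` {-e<..<e} \<subseteq> \<phi> ` (topspace T \<inter> N)" "(\<gamma> has_vector_derivative v) (at 0)"
      by (auto simp: tangent_space_def)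
    have "((\<lambda>h. norm (\<gamma> (0 + h) - \<gamma> 0 - h *\<^sub>R v) / norm h) \<longlongrightarrow> 0) (at 0)"
      using \<gamma>(4) unfolding has_vector_derivative_def has_derivative_at by blast
    then have "((\<lambda>h. norm ((\<gamma> h - \<gamma> 0) /\<^sub>R h - v)) \<longlongrightarrow> 0) (at 0)"
    proof (rule Lim_transform_eventually)
      have "norm (\<gamma> (0 + h) - \<gamma> 0 - h *\<^sub>R v) / norm h = norm ((\<gamma> h - \<gamma> 0) /\<^sub>R h - v)" if "h \<noteq> 0" for h
      proof -
        have "norm ((\<gamma> h - \<gamma> 0) /\<^sub>R h - v) = norm ((\<gamma> h - \<gamma> 0 - h *\<^sub>R v) /\<^sub>R h)"
          using that by (simp add: scaleR_diff_right)
        then show ?thesis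
          by (simp add: divide_inverse mult.commute)
      qed
      then show "\<forall>\<^sub>F h in at 0. norm (\<gamma> (0 + h) - \<gamma> 0 - h *\<^sub>R v) / norm h = norm ((\<gamma> h - \<gamma> 0) /\<^sub>R h - v)"
        by (auto simp: eventually_at_filter)
    qed
    from tendsto_norm_zero_cancel[OF this]
    have "((\<lambda>h. (\<gamma> h - \<gamma> 0) /\<^sub>R h) \<longlongrightarrow> v) (at 0)"
      by (rule Lim_null[THEN iffD2])
    moreover have "\<forall>\<^sub>F h in at 0. (\<gamma> h - \<gamma> 0) /\<^sub>R h \<in> F"
    proof -
      have "\<forall>\<^sub>F h in at 0. h \<in> {-e<..<e}"
        using \<gamma>(1) by (intro eventually_at_in_open') auto
      then show ?thesis
      proof eventually_elim
        case (elim h)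
        then have "\<gamma> h \<in> F"
          using \<gamma>(3) image by auto
        then show ?case
          using F(1) \<gamma>(2) x by (simp add: subspace_diff subspace_scale)
      qed
    qed
    ultimately show ?thesis
      using F(2) by (intro Lim_in_closed_set[of F _ "at 0"]) auto
  qed
  moreover have "v \<in> tangent_space chart N x" if v: "v \<in> F" for v
  proof -
    define \<gamma> where "\<gamma> t = \<phi> x + t *\<^sub>R v" for t :: real
    have "open (\<gamma> -` (\<phi> ` topspace T))"
      unfolding \<gamma>_def by (intro open_vimage open_image continuous_intros)
    moreover have "0 \<in> \<gamma> -` (\<phi> ` topspace T)"
      using x by (simp add: \<gamma>_def)
    ultimately obtain e where e: "e > 0" "ball 0 e \<subseteq> \<gamma> -` (\<phi> ` topspace T)"
      by (meson open_contains_ball)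
    have "\<gamma> ` {-e<..<e} \<subseteq> \<phi> ` topspace T"
      using e(2) by (auto simp: subset_iff dist_real_def)
    moreover have "\<gamma> t \<in> F" for t
      using F(1) x(2) v by (simp add: \<gamma>_def subspace_add subspace_scale)
    ultimately have "\<gamma> ` {-e<..<e} \<subseteq> \<phi> ` (topspace T \<inter> N)"
      unfolding image by blast
    moreover have "smooth_on {-e<..<e} \<gamma>"
      by (rule smooth_on_affine[of _ "\<lambda>t. t *\<^sub>R v" _ "\<phi> x"]) (auto simp: \<gamma>_def bounded_linear_scaleR_left)
    moreover have "(\<gamma> has_vector_derivative v) (at 0)"
      unfolding \<gamma>_def by (auto intro!: derivative_eq_intros)
    ultimately show ?thesis
      unfolding tangent_space_def using e(1) by (auto simp: \<gamma>_def intro!: exI[of _ \<gamma>] exI[of _ e])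
  qed
  ultimately show ?thesis
    by blast
qed

text \<open>The fibre over every point is \<open>F'/F\<close>, and a coset of \<open>F\<close> meets the complement \<open>W\<close> in exactly
  one point. This point identifies \<open>F'/F\<close> with \<open>F' \<inter> W\<close>; on representatives it is the bounded
  projection \<open>\<pi>\<close> onto \<open>W\<close>, so the trivialisation is smooth. Taking \<open>F'\<close> to be the
  whole space gives the normal bundle in the manifold.\<close>

lemma trivial_normal_bundle_slice:
  assumes F: "finite_dim F" "subspace F" "closed_complement F W" and F': "subspace F'" "closed F'" "F \<subseteq> F'"
    and N: "N = {x \<in> topspace T. \<phi> x \<in> F}" and N': "N' = {x \<in> topspace T. \<phi> x \<in> F'}"
  shows "trivial_normal_bundle {chart} N N'"
proof -
  obtain \<pi> where \<pi>: "bounded_linear \<pi>" "\<And>x. \<pi> x \<in> W" "\<And>x. x - \<pi> x \<in> F"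
      "\<And>x w. w \<in> W \<Longrightarrow> x - w \<in> F \<Longrightarrow> w = \<pi> x"
    using projection_along_finite_dim[OF F(1,3)] by blast
  interpret \<pi>: bounded_linear \<pi>
    by (rule \<pi>(1))
  have W: "subspace W" "closed W"
    using F(3) by (auto simp: closed_complement_def alg_complement_def)
  have tN: "tangent_space chart N x = F" and tN': "tangent_space chart N' x = F'" if "x \<in> topspace T \<inter> N" for x
  proof -
    have "x \<in> topspace T" "\<phi> x \<in> F" "\<phi> x \<in> F'"
      using that N F'(3) by auto
    then show "tangent_space chart N x = F" "tangent_space chart N' x = F'"
      using tangent_space_slice[OF F(2) closed_finite_dim[OF F(1)] _ _ N]
        tangent_space_slice[OF F'(1,2) _ _ N'] by blast+
  qed
  define \<tau> :: "('x, 'p) chart \<Rightarrow> 'x \<Rightarrow> 'p set \<Rightarrow> 'p" where "\<tau> c x X = (THE w. w \<in> X \<inter> W)" for c x X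
  have \<tau>: "\<tau> c x (normal_class chart N x v) = \<pi> v" if "x \<in> topspace T \<inter> N" for c x v
    unfolding \<tau>_def normal_class_def tN[OF that]
  proof (rule the_equality)
    have "\<pi> v - v \<in> F"
      using subspace_neg[OF F(2) \<pi>(3)[of v]] by simp
    then show "\<pi> v \<in> (\<lambda>w. v + w) ` F \<inter> W"
      using \<pi>(2) by (auto intro!: image_eqI[of _ _ "\<pi> v - v"])
    fix w assume "w \<in> (\<lambda>w. v + w) ` F \<inter> W"
    then obtain u where u: "u \<in> F" "w = v + u" "w \<in> W"
      by blast
    then have "v - w \<in> F"
      using subspace_neg[OF F(2) u(1)] by simp
    then show "w = \<pi> v"
      using \<pi>(4) u by blast
  qed
  have class_eq: "normal_class chart N x u = normal_class chart N x v"
    if x: "x \<in> topspace T \<inter> N" and "\<pi> u = \<pi> v" for x u v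
  proof -
    have "u - v = (u - \<pi> u) - (v - \<pi> v)"
      using that by simp
    also have "\<dots> \<in> F"
      by (intro subspace_diff F(2) \<pi>(3))
    finally have uv: "u - v \<in> F" .
    have "(+) u ` F = (+) v ` F"
    proof (intro equalityI subsetI; elim imageE)
      fix y f assume "y = u + f" "f \<in> F"
      then show "y \<in> (+) v ` F"
        using subspace_add[OF F(2) uv, of f] by (intro image_eqI[of _ _ "u - v + f"]) auto
    next
      fix y f assume "y = v + f" "f \<in> F"
      then show "y \<in> (+) u ` F"
        using subspace_diff[OF F(2) _ uv, of f] by (intro image_eqI[of _ _ "f - (u - v)"]) auto
    qed
    then show ?thesis
      by (simp add: normal_class_def tN[OF x])
  qed
  have bij: "bij_betw (\<tau> chart x) (normal_fibre chart N N' x) (F' \<inter> W)" if x: "x \<in> topspace T \<inter> N" for x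
  proof (rule bij_betw_imageI)
    show "inj_on (\<tau> chart x) (normal_fibre chart N N' x)"
    proof (rule inj_onI)
      fix X Y
      assume "X \<in> normal_fibre chart N N' x" "Y \<in> normal_fibre chart N N' x"
        and eq: "\<tau> chart x X = \<tau> chart x Y"
      then obtain u v where uv: "X = normal_class chart N x u" "Y = normal_class chart N x v"
        by (auto simp: normal_fibre_def)
      with eq have "\<pi> u = \<pi> v"
        by (simp only: \<tau>[OF x])
      then show "X = Y"
        unfolding uv by (rule class_eq[OF x])
    qed
    have "\<pi> v \<in> F'" if "v \<in> F'" for v
      using subspace_diff[OF F'(1) that, of "v - \<pi> v"] \<pi>(3)[of v] F'(3) by auto
    moreover have "\<pi> v = v" if "v \<in> W" for v
      using \<pi>(4)[OF that, of v] F(2) by (simp add: subspace_0)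
    ultimately have "\<pi> ` F' = F' \<inter> W"
      using \<pi>(2) by force
    then show "\<tau> chart x ` normal_fibre chart N N' x = F' \<inter> W"
      unfolding normal_fibre_def tN'[OF x] by (simp add: image_image \<tau>[OF x])
  qed
  have smooth: "locally_extends_smoothly
      {(\<phi> x, v) |x v. x \<in> topspace T \<inter> N \<and> v \<in> tangent_space chart N' x}
      (\<lambda>(y, v). \<tau> chart (chart_inv chart y) (normal_class chart N (chart_inv chart y) v))"
    unfolding locally_extends_smoothly_def
  proof (intro ballI exI conjI)
    show "smooth_on UNIV (\<pi> \<circ> snd :: 'p \<times> 'p \<Rightarrow> 'p)"
      by (rule smooth_on_affine[OF open_UNIV bounded_linear_compose[OF \<pi>(1) bounded_linear_snd], of _ 0]) simp
  qed (auto simp: chart_inv_chart \<tau>)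
  have transition: "\<tau> chart x (chart_deriv chart \<phi> x ` X) = \<tau> chart x X" if "x \<in> topspace T" for x X
    by (simp add: chart_deriv_chart[OF that])
  show ?thesis
    unfolding trivial_normal_bundle_def
  proof (intro exI conjI)
    show "subspace (F' \<inter> W)" "closed (F' \<inter> W)"
      using F' W by (auto simp: subspace_inter)
    show "\<forall>c\<in>{chart}. \<forall>x\<in>fst c \<inter> N. bij_betw (\<tau> c x) (normal_fibre c N N' x) (F' \<inter> W) \<and>
        (\<forall>u\<in>tangent_space c N' x. \<forall>v\<in>tangent_space c N' x. \<forall>r s.
          \<tau> c x (normal_class c N x (r *\<^sub>R u + s *\<^sub>R v)) =
            r *\<^sub>R \<tau> c x (normal_class c N x u) + s *\<^sub>R \<tau> c x (normal_class c N x v))"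
      using bij by (simp add: \<tau> \<pi>.add \<pi>.scale)
    show "\<forall>c\<in>{chart}. \<forall>d\<in>{chart}. \<forall>x\<in>fst c \<inter> fst d \<inter> N. \<forall>X\<in>normal_fibre c N N' x.
        \<tau> d x (chart_deriv c (snd d) x ` X) = \<tau> c x X"
      using transition by simp
    show "\<forall>c\<in>{chart}. locally_extends_smoothly
        {(snd c x, v) |x v. x \<in> fst c \<inter> N \<and> v \<in> tangent_space c N' x}
        (\<lambda>(y, v). \<tau> c (chart_inv c y) (normal_class c N (chart_inv c y) v))"
      using smooth by simp
  qed
qed

lemma closure_of_slices:
  assumes dense: "closure (\<Union>n\<in>I. F n) = UNIV" and N: "\<And>n. n \<in> I \<Longrightarrow> N n = {x \<in> topspace T. \<phi> x \<in> F n}"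
  shows "T closure_of (\<Union>n\<in>I. N n) = topspace T"
proof -
  have "x \<in> T closure_of (\<Union>n\<in>I. N n)" if x: "x \<in> topspace T" for x
    unfolding in_closure_of
  proof (intro conjI allI impI, fact x, elim conjE)
    fix G assume G: "x \<in> G" "openin T G"
    have "openin (top_of_set (\<phi> ` topspace T)) (\<phi> ` G)"
      using homeo G(2) by (simp add: homeomorphic_eq_everything_map open_map_def)
    then have "open (\<phi> ` G)"
      using open_image openin_open_trans openin_open_eq by blast
    then obtain y where "y \<in> \<phi> ` G" "y \<in> (\<Union>n\<in>I. F n)"
      using open_Int_closure_eq_empty[of "\<phi> ` G" "\<Union>n\<in>I. F n"] dense G(1) by blast
    then show "\<exists>y. y \<in> (\<Union>n\<in>I. N n) \<and> y \<in> G"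
      using N openin_subset[OF G(2)] by fastforce
  qed
  then show ?thesis
    by (intro equalityI closure_of_subset_topspace subsetI)
qed

text \<open>The chart is the Fredholm map, and the slices inherit all properties from the flag.\<close>

theorem fredholm_filtration_slices:
  assumes F: "delta_flag \<delta> F FC" and N: "\<And>n. n \<ge> 1 \<Longrightarrow> N n = {x \<in> topspace T. \<phi> x \<in> F n}"
  shows "fredholm_filtration TYPE('p) T {chart} \<delta> N"
proof -
  have mono: "strict_mono_on {1..} \<delta>"
    and dim: "\<And>n. n \<ge> 1 \<Longrightarrow> has_dim (F n) (\<delta> n)"
    and step: "\<And>n. n \<ge> 1 \<Longrightarrow> F n \<subseteq> F (Suc n)"
    and dense: "closure (\<Union>n\<in>{1..}. F n) = UNIV"
    and compl: "\<And>n. n \<ge> 1 \<Longrightarrow> closed_complement (F n) (FC n)"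
    using F by (auto simp: delta_flag_def)
  note F_facts = has_dim_span[OF dim]
  have "smooth_submanifold T {chart} (\<delta> n) (N n)" if n: "n \<ge> 1" for n
    unfolding smooth_submanifold_def
  proof (intro conjI ballI exI)
    show "is_chart T chart" "has_dim (F n) (\<delta> n)"
      using is_chart_chart dim[OF n] by auto
    show "snd chart ` (fst chart \<inter> N n) = snd chart ` fst chart \<inter> F n"
      by (auto simp: N[OF n])
  qed (auto simp: charts_compatible_chart N[OF n])
  moreover have "N n \<subseteq> N (Suc n)" if "n \<ge> 1" for n
    using step[OF that] N[of n] N[of "Suc n"] that by auto
  moreover have "trivial_normal_bundle {chart} (N n) (N (Suc n))" if n: "n \<ge> 1" for n
    using n F_facts[of n] F_facts[of "Suc n"] step compl N
    by (intro trivial_normal_bundle_slice[of "F n" "FC n" "F (Suc n)"]) auto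
  moreover have "trivial_normal_bundle {chart} (N n) (topspace T)" if n: "n \<ge> 1" for n
    using n F_facts[of n] compl N
    by (intro trivial_normal_bundle_slice[of "F n" "FC n" UNIV]) auto
  moreover have "T closure_of (\<Union>n\<in>{1..}. N n) = topspace T"
    using closure_of_slices[OF dense] N by auto
  moreover have "homotopy_equivalence (inductive_limit_topology T N) T id"
    by (rule homotopy_equivalence_inductive_limit[OF homeo open_image _ _ _ dense])
      (use F_facts step N in auto)
  moreover have "\<exists>(f :: 'x \<Rightarrow> 'p) B BC. fredholm_map_index_zero {chart} f \<and> delta_flag \<delta> B BC \<and>
      (\<forall>n\<ge>1. transverse {chart} f (B n) \<and> N n = {x \<in> topspace T. f x \<in> B n})"
  proof (intro exI conjI allI impI)
    show "transverse {chart} \<phi> (F n)" if "n \<ge> 1" for n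
      by (rule transverse_chart[OF compl[OF that]])
  qed (use fredholm_map_chart F N in simp_all)
  ultimately show ?thesis
    unfolding fredholm_filtration_def using smooth_banach_manifold_chart mono by simp
qed

end

section \<open>The Fredholm group\<close>

text \<open>For every \<open>y\<close> the equation \<open>x + A x = y\<close> is the fixed point equation of the contraction
  \<open>x \<mapsto> y - A x\<close>.\<close>

lemma id_plus_small_in_GL:
  fixes A :: "'a::banach \<Rightarrow>\<^sub>L 'a"
  assumes A: "norm A < 1"
  shows "id_blinfun + A \<in> GL"
proof -
  have A_le: "norm (blinfun_apply A x) \<le> norm A * norm x" for x
    by (rule norm_blinfun)
  have "\<exists>!x. y - blinfun_apply A x = x" for y
  proof (rule banach_fix_type[of "norm A"])
    have "dist (y - blinfun_apply A u) (y - blinfun_apply A v) \<le> norm A * dist u v" for u v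
      using A_le[of "v - u"] by (simp add: dist_norm blinfun.diff_right norm_minus_commute)
    then show "\<forall>u v. dist (y - blinfun_apply A u) (y - blinfun_apply A v) \<le> norm A * dist u v"
      by blast
  qed (use A in auto)
  then have "\<exists>!x. x + blinfun_apply A x = y" for y
    by (metis add_diff_cancel diff_add_cancel)
  then obtain R where R: "\<And>y. R y + blinfun_apply A (R y) = y" "\<And>x y. x + blinfun_apply A x = y \<Longrightarrow> x = R y"
    by metis
  have "bounded_linear R"
  proof (rule bounded_linear_intro)
    show "R (x + y) = R x + R y" for x y
      using R(1)[of x] R(1)[of y] by (intro R(2)[symmetric]) (simp add: blinfun.add_right algebra_simps)
    show "R (r *\<^sub>R x) = r *\<^sub>R R x" for r x
      using arg_cong[OF R(1)[of x], of "scaleR r"]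
      by (intro R(2)[symmetric]) (simp add: blinfun.scaleR_right scaleR_add_right)
    show "norm (R y) \<le> norm y * (1 / (1 - norm A))" for y
    proof -
      have "norm (R y) = norm (y - blinfun_apply A (R y))"
        using R(1)[of y] by (metis add_diff_cancel_right')
      then have "norm (R y) \<le> norm y + norm A * norm (R y)"
        using norm_triangle_ineq4[of y "blinfun_apply A (R y)"] A_le[of "R y"] by linarith
      then show ?thesis
        using A by (simp add: field_simps)
    qed
  qed
  then have "Blinfun R o\<^sub>L (id_blinfun + A) = id_blinfun \<and> (id_blinfun + A) o\<^sub>L Blinfun R = id_blinfun"
    using R by (auto intro!: blinfun_eqI simp: bounded_linear_Blinfun_apply blinfun.add_left R(2)[symmetric])
  then show ?thesis
    unfolding GL_def by blast
qed

lemma compose_in_GL: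
  assumes "S \<in> GL" "T \<in> GL"
  shows "S o\<^sub>L T \<in> GL"
proof -
  obtain S' T' where inv: "S' o\<^sub>L S = id_blinfun" "S o\<^sub>L S' = id_blinfun" "T' o\<^sub>L T = id_blinfun" "T o\<^sub>L T' = id_blinfun"
    using assms unfolding GL_def by blast
  have pt: "blinfun_apply S' (blinfun_apply S x) = x" "blinfun_apply S (blinfun_apply S' x) = x"
    "blinfun_apply T' (blinfun_apply T x) = x" "blinfun_apply T (blinfun_apply T' x) = x" for x
    using inv[THEN arg_cong, of "\<lambda>A. blinfun_apply A x"] by simp_all
  have "(T' o\<^sub>L S') o\<^sub>L (S o\<^sub>L T) = id_blinfun \<and> (S o\<^sub>L T) o\<^sub>L (T' o\<^sub>L S') = id_blinfun"
    by (auto intro!: blinfun_eqI simp: pt)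
  then show ?thesis
    unfolding GL_def by blast
qed

text \<open>If \<open>S\<close> is inverse to \<open>T\<close>, then \<open>T' = T (I + S (T' - T))\<close>, and \<open>id_plus_small_in_GL\<close> applies to the second factor when
  \<open>T'\<close> is close to \<open>T\<close>.\<close>

lemma open_GL: "open (GL :: ('a::banach \<Rightarrow>\<^sub>L 'a) set)"
  unfolding open_dist
proof (rule ballI)
  fix T :: "'a \<Rightarrow>\<^sub>L 'a"
  assume T: "T \<in> GL"
  then obtain S where S: "T o\<^sub>L S = id_blinfun"
    unfolding GL_def by blast
  have pt: "blinfun_apply T (blinfun_apply S x) = x" for x
    using arg_cong[OF S, of "\<lambda>A. blinfun_apply A x"] by simp
  define e where "e = 1 / (norm S + 1)"
  have "T' \<in> GL" if "dist T' T < e" for T'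
  proof -
    have "norm (S o\<^sub>L (T' - T)) \<le> norm S * norm (T' - T)"
      by (rule norm_blinfun_compose)
    also have "\<dots> \<le> norm S * e"
      using that by (intro mult_left_mono) (auto simp: dist_norm)
    also have "\<dots> < 1"
      using norm_ge_zero[of S] by (simp add: e_def field_simps del: norm_ge_zero)
    finally have "T o\<^sub>L (id_blinfun + (S o\<^sub>L (T' - T))) \<in> GL"
      using compose_in_GL[OF T id_plus_small_in_GL] by blast
    moreover have "T o\<^sub>L (id_blinfun + (S o\<^sub>L (T' - T))) = T'"
      by (rule blinfun_eqI) (simp add: blinfun.add_left blinfun.diff_left blinfun.add_right pt)
    ultimately show ?thesis
      by simp
  qed
  moreover have "e > 0"
    by (simp add: e_def add_nonneg_pos)
  ultimately show "\<exists>e>0. \<forall>T'. dist T' T < e \<longrightarrow> T' \<in> GL"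
    by blast
qed

lemma flag_GL_iff:
  assumes "alg_complement (E n) (EC n)" "subspace (E n)"
  shows "T \<in> flag_GL E EC n \<longleftrightarrow> T \<in> GL \<and> T - id_blinfun \<in> flag_M E EC n"
proof -
  have "blinfun_apply (T - id_blinfun) ` E n \<subseteq> E n \<longleftrightarrow> blinfun_apply T ` E n \<subseteq> E n"
  proof -
    have "blinfun_apply (T - id_blinfun) x \<in> E n \<longleftrightarrow> blinfun_apply T x \<in> E n" if "x \<in> E n" for x
      using subspace_add[OF assms(2) _ that, of "blinfun_apply T x - x"]
        subspace_diff[OF assms(2) _ that, of "blinfun_apply T x"] by (auto simp: blinfun.diff_left)
    then show ?thesis
      by blast
  qed
  then show ?thesis
    by (auto simp: flag_GL_def flag_M_def blinfun.diff_left)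
qed

text \<open>This places \<open>M(n)\<close>, and with it \<open>GL(n) - I\<close>, inside every perturbation class.\<close>

lemma flag_M_subset_finite_rank_ops:
  assumes "alg_complement (E n) (EC n)" "finite_dim (E n)"
  shows "flag_M E EC n \<subseteq> finite_rank_ops"
proof
  fix T assume T: "T \<in> flag_M E EC n"
  have "blinfun_apply T x \<in> E n" for x
  proof -
    have "x \<in> {v + w |v w. v \<in> E n \<and> w \<in> EC n}"
      using assms(1) by (simp add: alg_complement_def)
    then obtain v w where "x = v + w" "v \<in> E n" "w \<in> EC n"
      by blast
    then show ?thesis
      using T by (auto simp: flag_M_def blinfun.add_right)
  qed
  moreover have "subspace (range (blinfun_apply T))"
    by (intro linear_subspace_image subspace_UNIV bounded_linear.linear blinfun.bounded_linear_right)
  ultimately show "T \<in> finite_rank_ops"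
    unfolding finite_rank_ops_def using finite_dim_subspace[OF assms(2)] by blast
qed

text \<open>The preimage of the open set of invertible operators under the continuous map \<open>K \<mapsto> I + K\<close> is the
  image of the chart.\<close>

lemma global_chart_GL_P:
  fixes incl :: "'p::{real_normed_algebra,banach} \<Rightarrow> ('a::banach \<Rightarrow>\<^sub>L 'a)"
  assumes "banach_perturbation_class P incl"
  shows "global_chart (GL_P_topology P incl) (GL_P_coord incl)"
    and "topspace (GL_P_topology P incl) = GL_P P"
proof -
  have incl: "bounded_linear incl" "inj incl" "range incl = P"
    using assms by (auto simp: banach_perturbation_class_def)
  let ?T = "GL_P_topology P incl" and ?\<phi> = "GL_P_coord incl"
  let ?O = "{K. id_blinfun + incl K \<in> GL}" and ?\<psi> = "\<lambda>K. id_blinfun + incl K"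
  show top: "topspace ?T = GL_P P"
    by (simp add: GL_P_topology_def topspace_pullback_topology)
  have \<phi>\<psi>: "?\<phi> (?\<psi> K) = K" for K
    by (simp add: GL_P_coord_def the_inv_f_f[OF incl(2)])
  have GL_P: "GL_P P = ?\<psi> ` ?O"
    using incl(3) by (auto simp: GL_P_def)
  then have image: "?\<phi> ` topspace ?T = ?O"
    by (simp add: top image_image \<phi>\<psi>)
  have incl_cont: "continuous_on UNIV incl"
    using incl(1) linear_continuous_on by blast
  have "open (?\<psi> -` GL)"
    by (intro open_vimage open_GL continuous_intros incl_cont)
  then have "open ?O"
    by (simp add: vimage_def)
  moreover have "homeomorphic_maps ?T (top_of_set ?O) ?\<phi> ?\<psi>"
    unfolding homeomorphic_maps_def
  proof (intro conjI ballI)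
    have "continuous_map ?T euclidean (id \<circ> ?\<phi>)"
      unfolding GL_P_topology_def by (rule continuous_map_pullback) simp
    then show "continuous_map ?T (top_of_set ?O) ?\<phi>"
      using image by (auto simp: continuous_map_in_subtopology)
    have "continuous_map (top_of_set ?O) euclidean (?\<phi> \<circ> ?\<psi>)"
      by (simp add: \<phi>\<psi> o_def)
    then show "continuous_map (top_of_set ?O) ?T ?\<psi>"
      unfolding GL_P_topology_def by (rule continuous_map_pullback') (auto simp: GL_P)
  qed (auto simp: top GL_P \<phi>\<psi>)
  ultimately show "global_chart ?T ?\<phi>"
    unfolding global_chart_def image using homeomorphic_map_maps by blast
qed

theorem theorem7:
  fixes P :: "('a::banach \<Rightarrow>\<^sub>L 'a) set"
    and incl :: "'p::{real_normed_algebra,banach} \<Rightarrow> ('a \<Rightarrow>\<^sub>L 'a)"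
    and E EC :: "nat \<Rightarrow> 'a set"
  assumes "separable_space (euclidean :: 'a topology)"
    and "\<not> finite_dim (UNIV :: 'a set)"
    and "matricial P incl"
    and "N_flag E EC"
    and "induces_flag incl E EC"
  shows "fredholm_filtration TYPE('p) (GL_P_topology P incl) (GL_P_atlas P incl)
           (\<lambda>n. n^2) (flag_GL E EC)"
proof -
  have P: "banach_perturbation_class P incl"
    using assms(3) by (simp add: matricial_def)
  then have incl: "inj incl" "range incl = P" and finite_rank: "finite_rank_ops \<subseteq> P"
    by (auto simp: banach_perturbation_class_def perturbation_class_def)
  obtain MC where MC: "delta_flag (\<lambda>n. n\<^sup>2) (\<lambda>n. incl -` flag_M E EC n) MC"
    using assms(5) by (auto simp: induces_flag_def)
  interpret global_chart "GL_P_topology P incl" "GL_P_coord incl"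
    by (rule global_chart_GL_P[OF P])
  note top = global_chart_GL_P(2)[OF P]
  have "flag_GL E EC n = {T \<in> topspace (GL_P_topology P incl). GL_P_coord incl T \<in> incl -` flag_M E EC n}"
    if n: "n \<ge> 1" for n
  proof -
    have "has_dim (E n) n" and compl: "alg_complement (E n) (EC n)"
      using assms(4) n by (auto simp: N_flag_def delta_flag_def closed_complement_def)
    note En = has_dim_span[OF this(1)]
    have "flag_M E EC n \<subseteq> P"
      using flag_M_subset_finite_rank_ops[of E n EC, OF compl En(2)] finite_rank by blast
    moreover have GL_P: "T \<in> GL_P P \<longleftrightarrow> T \<in> GL \<and> T - id_blinfun \<in> P" for T
      by (auto simp: GL_P_def intro!: exI[of _ "T - id_blinfun"])
    moreover have "incl (GL_P_coord incl T) = T - id_blinfun" if "T - id_blinfun \<in> P" for T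
      unfolding GL_P_coord_def using f_the_inv_into_f[OF incl(1)] incl(2) that by auto
    ultimately show ?thesis
      unfolding top using flag_GL_iff[of E n EC, OF compl En(1)] by auto
  qed
  from fredholm_filtration_slices[OF MC this] show ?thesis
    by (simp add: GL_P_atlas_def top)
qed

end
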